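(* Let $m,n$ be positive integers and let $T$ be a tower of type $(m,n)$ over a minimal rotation. Then: (1) $T$ is conjugate (in $\mathbb{G}$) to a minimal rotation if and only if $m$ and $n$ are relatively prime. (2) If $m$ and $n$ are not relatively prime, and $d>1$ is their greatest common divisor, then $T$ is conjugate (in $\mathbb{G}$) to a tower of constant height $d$ over a minimal rotation. In either case, $T$ has a $p^{th}$ root in $\mathbb{G}$ for some integer $p\geq 2$.
   Context: Interval exchange transformations (IETs): fix $r\in\mathbb{N}$, $r\ge 1$, a permutation $\pi$ of $\{1,\dots,r\}$, and $\lambda=(\lambda_1,\dots,\lambda_r)$ with $\lambda_i>0$ and $\sum_i\lambda_i=1$. Put $\beta_0=0$, $\beta_j=\lambda_1+\cdots+\lambda_j$, and $I_j=[\beta_{j-1},\beta_j)$ for $1\le j\le r$. The $r$-IET $T_{(\pi,\lambda)}:[0,1)\to[0,1)$ is the bijection given by $T_{(\pi,\lambda)}(x)=x-\sum_{i<j}\lambda_i+\sum_{\pi(i)<\pi(j)}\lambda_i$ for $x\in I_j$. The set of all IETs forms a group $\mathbb{G}$ under composition; conjugate means conjugate in $\mathbb{G}$. $T$ is minimal if every orbit $\{T^k(x):k\in\mathbb{Z}\}$ is dense in $[0,1)$. $T$ has a $p^{th}$ root in $\mathbb{G}$ if there is $S\in\mathbb{G}$ with $T=S^p$ ($p$-fold composition). A rotation is a $2$-IET whose permutation interchanges $1$ and $2$. Towers: let $R$ be an $r$-IET exchanging the intervals $I_1,\dots,I_r$, and let $n_1,\dots,n_r$ be positive integers. Let $f:[0,1)\to\mathbb{N}$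 with $f(x)=n_j$ for $x\in I_j$. On the set $\{(x,i):x\in[0,1),\ 1\le i\le f(x)\}$ define $R_f(x,i)=(x,i+1)$ if $i+1\le f(x)$, and $R_f(x,i)=(R(x),1)$ otherwise. Laying the levels of this domain (level $i$ consists of the intervals $I_j\times\{i\}$ with $n_j\ge i$) end to end and rescaling so that the total length is $1$, one views $R_f$ as an IET of $[0,1)$, called a tower of type $(n_1,\dots,n_r)$ over $R$. (Different arrangements of the intervals $I_j\times\{i\}$ inside $[0,1)$ give conjugate IETs.) If $n_1=\cdots=n_r=d$ it is called a tower of constant height $d$. *)

theory Defs
  imports "HOL-Analysis.Analysis" "HOL-Combinatorics.Permutations"
begin

definition iet_data :: "nat \<Rightarrow> (nat \<Rightarrow> nat) \<Rightarrow> (nat \<Rightarrow> real) \<Rightarrow> bool" where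
  "iet_data r \<pi> l \<longleftrightarrow>
     1 \<le> r \<and> \<pi> permutes {1..r} \<and> (\<forall>i\<in>{1..r}. 0 < l i) \<and> (\<Sum>i\<in>{1..r}. l i) = 1"

definition breakpt :: "(nat \<Rightarrow> real) \<Rightarrow> nat \<Rightarrow> real" where
  "breakpt l j = (\<Sum>i\<in>{1..j}. l i)"

definition interv :: "(nat \<Rightarrow> real) \<Rightarrow> nat \<Rightarrow> real set" where
  "interv l j = {breakpt l (j - 1)..<breakpt l j}"

definition interv_index :: "nat \<Rightarrow> (nat \<Rightarrow> real) \<Rightarrow> real \<Rightarrow> nat" where
  "interv_index r l x = (THE j. j \<in> {1..r} \<and> x \<in> interv l j)"

text \<open>
  Self-maps of \<open>[0,1)\<close> are extended by the identity to all reals, so that equality,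
  composition, iteration and \<^term>\<open>inv\<close> of functions are those of the group of interval
  exchange transformations.
\<close>

definition iet :: "nat \<Rightarrow> (nat \<Rightarrow> nat) \<Rightarrow> (nat \<Rightarrow> real) \<Rightarrow> real \<Rightarrow> real" where
  "iet r \<pi> l x =
     (if x \<in> {0..<1}
      then let j = interv_index r l x
           in x - (\<Sum>i | i \<in> {1..r} \<and> i < j. l i) + (\<Sum>i | i \<in> {1..r} \<and> \<pi> i < \<pi> j. l i)
      else x)"

definition IETs :: "(real \<Rightarrow> real) set" where
  "IETs = {iet r \<pi> l | r \<pi> l. iet_data r \<pi> l}"

definition conjugate :: "(real \<Rightarrow> real) \<Rightarrow> (real \<Rightarrow> real) \<Rightarrow> bool" where
  "conjugate S T \<longleftrightarrow> (\<exists>g\<in>IETs. T = g \<circ> S \<circ> inv g)"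

definition has_root :: "nat \<Rightarrow> (real \<Rightarrow> real) \<Rightarrow> bool" where
  "has_root p T \<longleftrightarrow> (\<exists>S\<in>IETs. T = S ^^ p)"

definition full_orbit :: "(real \<Rightarrow> real) \<Rightarrow> real \<Rightarrow> real set" where
  "full_orbit T x = range (\<lambda>k. (T ^^ k) x) \<union> range (\<lambda>k. (inv T ^^ k) x)"

definition minimal :: "(real \<Rightarrow> real) \<Rightarrow> bool" where
  "minimal T \<longleftrightarrow> (\<forall>x\<in>{0..<1}. {0..<1} \<subseteq> closure (full_orbit T x))"

abbreviation swap12 :: "nat \<Rightarrow> nat" where
  "swap12 \<equiv> Transposition.transpose 1 2"

definition minimal_rotation :: "(real \<Rightarrow> real) \<Rightarrow> bool" where
  "minimal_rotation R \<longleftrightarrow> (\<exists>l. iet_data 2 swap12 l \<and> R = iet 2 swap12 l \<and> minimal R)"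

definition tower_dom :: "nat \<Rightarrow> (nat \<Rightarrow> real) \<Rightarrow> (nat \<Rightarrow> nat) \<Rightarrow> (real \<times> nat) set" where
  "tower_dom r l h = {(x, i). x \<in> {0..<1} \<and> 1 \<le> i \<and> i \<le> h (interv_index r l x)}"

definition tower_map ::
  "nat \<Rightarrow> (nat \<Rightarrow> nat) \<Rightarrow> (nat \<Rightarrow> real) \<Rightarrow> (nat \<Rightarrow> nat) \<Rightarrow> real \<times> nat \<Rightarrow> real \<times> nat" where
  "tower_map r \<pi> l h = (\<lambda>(x, i).
     if i + 1 \<le> h (interv_index r l x) then (x, i + 1) else (iet r \<pi> l x, 1))"

definition level_length :: "nat \<Rightarrow> (nat \<Rightarrow> real) \<Rightarrow> (nat \<Rightarrow> nat) \<Rightarrow> nat \<Rightarrow> real" where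
  "level_length r l h i = (\<Sum>j | j \<in> {1..r} \<and> i \<le> h j. l j)"

text \<open>
  Position in \<open>[0,1)\<close> of a point of the tower: the levels \<open>1, 2, \<dots>\<close> are laid from left to
  right, inside level \<open>i\<close> the intervals \<open>j\<close> with \<open>i \<le> h j\<close> are laid in increasing order of \<open>j\<close>
  without gaps, and everything is divided by the total length.
\<close>

definition tower_pos :: "nat \<Rightarrow> (nat \<Rightarrow> real) \<Rightarrow> (nat \<Rightarrow> nat) \<Rightarrow> real \<times> nat \<Rightarrow> real" where
  "tower_pos r l h = (\<lambda>(x, i).
     let j = interv_index r l x in
       ((\<Sum>k\<in>{1..<i}. level_length r l h k)
         + (\<Sum>q | q \<in> {1..<j} \<and> i \<le> h q. l q)
         + (x - breakpt l (j - 1)))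
       / (\<Sum>q\<in>{1..r}. real (h q) * l q))"

definition tower :: "nat \<Rightarrow> (nat \<Rightarrow> nat) \<Rightarrow> (nat \<Rightarrow> real) \<Rightarrow> (nat \<Rightarrow> nat) \<Rightarrow> real \<Rightarrow> real" where
  "tower r \<pi> l h y =
     (if y \<in> {0..<1}
      then tower_pos r l h
             (tower_map r \<pi> l h (inv_into (tower_dom r l h) (tower_pos r l h) y))
      else y)"

definition tower_over_minimal_rotation :: "nat \<Rightarrow> nat \<Rightarrow> (real \<Rightarrow> real) \<Rightarrow> bool" where
  "tower_over_minimal_rotation m n T \<longleftrightarrow>
     (\<exists>l. iet_data 2 swap12 l \<and> minimal (iet 2 swap12 l) \<and>
          T = tower 2 swap12 l (\<lambda>j. if j = 1 then m else n))"

end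

theory Submission
  imports Defs
begin

text \<open>
  Let \<open>l\<^sub>1 + l\<^sub>2 = 1\<close> be the interval lengths of the base rotation, and let \<open>d = gcd m n\<close>,
  \<open>m = d m'\<close>, \<open>n = d n'\<close>. By Bezout there is \<open>c\<close> such that, on a circle of length
  \<open>L = m' l\<^sub>1 + n' l\<^sub>2\<close>, rotating \<open>m'\<close> times by \<open>c\<close> is translation by \<open>l\<^sub>2\<close> and rotating \<open>n'\<close>
  times by \<open>c\<close> is translation by \<open>- l\<^sub>1\<close>. Sending the point \<open>x\<close> on level \<open>q d + s\<close>, where
  \<open>1 \<le> s \<le> d\<close>, to level \<open>s\<close> over the point \<open>x + q c\<close> of the circle conjugates the tower to the
  tower of constant height \<open>d\<close> over the rotation by \<open>c\<close>. If \<open>d > 1\<close>, the \<open>d\<close>-th power of the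
  latter preserves each level, which no conjugate of a minimal rotation allows. The tower of constant
  height \<open>d\<close> over the rotation by \<open>\<theta>\<close> commutes with the shifts of the circle coordinate, and its
  \<open>d\<close>-th power is the shift by \<open>\<theta>\<close>; composing it with the shift by \<open>- \<theta> / (d + 1)\<close> gives
  a root of order \<open>d + 1\<close>.
\<close>

subsection \<open>Interval exchanges as piecewise translations\<close>

locale tiling =
  fixes C :: "'a set" and s w :: "'a \<Rightarrow> real"
  assumes finite_C: "finite C"
    and w_pos: "c \<in> C \<Longrightarrow> 0 < w c"
    and sum_w: "sum w C = 1"
    and s_nonneg: "c \<in> C \<Longrightarrow> 0 \<le> s c"
    and end_le_1: "c \<in> C \<Longrightarrow> s c + w c \<le> 1"
    and separated: "\<lbrakk>c \<in> C; c' \<in> C; c \<noteq> c'\<rbrakk> \<Longrightarrow> s c + w c \<le> s c' \<or> s c' + w c' \<le> s c"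
begin

text \<open>Disjointness puts the cell with the largest left end beyond all others, so induction
  over left ends peels it off and leaves the rest inside \<open>[a, s x]\<close>.\<close>

lemma sum_le_length:
  assumes "A \<subseteq> C" "a \<le> b" "\<And>c. c \<in> A \<Longrightarrow> a \<le> s c" "\<And>c. c \<in> A \<Longrightarrow> s c + w c \<le> b"
  shows "sum w A \<le> b - a"
proof -
  have "finite A"
    using assms(1) finite_C finite_subset by blast
  then show ?thesis
    using assms
  proof (induction A arbitrary: b rule: finite_ranking_induct[where f = s])
    case empty
    then show ?case by simp
  next
    case (insert x A)
    show ?case
    proof (cases "x \<in> A")
      case True
      then show ?thesis
        using insert by (simp add: insert_absorb)
    next
      case False
      have "s y + w y \<le> s x" if "y \<in> A" for y
      proof -
        have "y \<in> C" "x \<in> C" "y \<noteq> x" "s y \<le> s x"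
          using False insert.hyps insert.prems(1) that by auto
        then show ?thesis
          using separated[of y x] w_pos[of x] by linarith
      qed
      then have "sum w A \<le> s x - a"
        using insert by auto
      moreover have "s x + w x \<le> b"
        using insert by auto
      ultimately show ?thesis
        using insert.hyps False by simp
    qed
  qed
qed

text \<open>\<open>sum_le_length\<close> bounds the cells left of \<open>c0\<close> by
  \<open>s c0\<close> and the others by \<open>1 - s c0\<close>; as all widths add up to 1, both
  bounds are attained. Positions are thus recovered from lengths.\<close>

lemma sum_before:
  assumes "c0 \<in> C"
  shows "sum w {c \<in> C. s c < s c0} = s c0"
proof -
  have 1: "sum w {c \<in> C. s c < s c0} \<le> s c0 - 0"
  proof (rule sum_le_length)
    show "s c + w c \<le> s c0" if "c \<in> {c \<in> C. s c < s c0}" for c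
      using separated[of c c0] that assms w_pos[of c0] by force
  qed (use assms s_nonneg in auto)
  have 2: "sum w {c \<in> C. \<not> s c < s c0} \<le> 1 - s c0"
    by (rule sum_le_length) (use end_le_1 w_pos[OF assms] end_le_1[OF assms] in \<open>auto simp: not_less\<close>)
  have "sum w C = sum w {c \<in> C. s c < s c0} + sum w {c \<in> C. \<not> s c < s c0}"
    by (subst sum.union_disjoint[symmetric]) (auto simp: finite_C intro: sum.cong)
  then show ?thesis
    using 1 2 sum_w by simp
qed

text \<open>If no cell contained \<open>z\<close>, the cells starting at or before \<open>z\<close>
  would fit into \<open>[0, z]\<close> and the others into \<open>[z1, 1]\<close> with
  \<open>z1 > z\<close>, so the total width would be below 1.\<close>

lemma covers:
  assumes "0 \<le> z" "z < 1"
  shows "\<exists>c\<in>C. s c \<le> z \<and> z < s c + w c"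
proof (rule ccontr)
  assume none: "\<not> ?thesis"
  define B where "B = {c \<in> C. \<not> s c \<le> z}"
  have 1: "sum w {c \<in> C. s c \<le> z} \<le> z - 0"
    by (rule sum_le_length) (use assms none s_nonneg in \<open>auto simp: not_less\<close>)
  have 2: "sum w C = sum w {c \<in> C. s c \<le> z} + sum w B"
    unfolding B_def by (subst sum.union_disjoint[symmetric]) (auto simp: finite_C intro: sum.cong)
  have "finite B"
    using finite_C by (simp add: B_def)
  show False
  proof (cases "B = {}")
    case True
    then show ?thesis using 1 2 sum_w assms by simp
  next
    case False
    define z1 where "z1 = Min (s ` B)"
    have "z1 \<in> s ` B" 
      using \<open>finite B\<close> False by (simp add: z1_def)
    then have "z < z1" "z1 \<le> 1"
      using end_le_1 w_pos unfolding B_def by force+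
    have "sum w B \<le> 1 - z1"
      by (rule sum_le_length) (use \<open>z1 \<le> 1\<close> \<open>finite B\<close> end_le_1 in \<open>auto simp: z1_def B_def\<close>)
    then show ?thesis using 1 2 sum_w \<open>z < z1\<close> by simp
  qed
qed

lemma cell_unique:
  assumes "c \<in> C" "c' \<in> C" "s c \<le> z" "z < s c + w c" "s c' \<le> z" "z < s c' + w c'"
  shows "c = c'"
  using separated[of c c'] assms by fastforce

lemma inj_on_s: "inj_on s C"
  by (rule inj_onI) (metis cell_unique less_add_same_cancel1 order_refl w_pos)

end

text \<open>The cells are laid end to end in the order of the key \<open>p\<close>: the index for
  the intervals before an exchange, \<pi> for the intervals after it.\<close>

lemma tiling_of_order:
  assumes "finite C" "\<And>c. c \<in> C \<Longrightarrow> 0 < w c" "sum w C = 1" "inj_on (p :: 'a \<Rightarrow> nat) C"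
  shows "tiling C (\<lambda>c. sum w {c' \<in> C. p c' < p c}) w"
proof
  have w0: "\<And>c. c \<in> C \<Longrightarrow> 0 \<le> w c"
    using assms(2) by force
  have step: "sum w {c' \<in> C. p c' < p c} + w c = sum w (insert c {c' \<in> C. p c' < p c})" for c
    using assms(1) by simp
  show "sum w {c' \<in> C. p c' < p c} + w c \<le> 1" if "c \<in> C" for c
    unfolding step assms(3)[symmetric] using w0 assms(1) that by (intro sum_mono2) auto
  show "sum w {c' \<in> C. p c' < p c} + w c \<le> sum w {c'' \<in> C. p c'' < p c'} \<or>
        sum w {c'' \<in> C. p c'' < p c'} + w c' \<le> sum w {c' \<in> C. p c' < p c}"
    if "c \<in> C" "c' \<in> C" "c \<noteq> c'" for c c'
  proof -
    have "p c \<noteq> p c'"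
      using that assms(4) by (auto dest: inj_onD)
    then consider "p c < p c'" | "p c' < p c" by linarith
    then show ?thesis
    proof cases
      case 1
      then show ?thesis unfolding step
        using w0 assms(1) that by (intro disjI1 sum_mono2) auto
    next
      case 2
      then show ?thesis unfolding step
        using w0 assms(1) that by (intro disjI2 sum_mono2) auto
    qed
  qed
next
  show "0 \<le> sum w {c' \<in> C. p c' < p c}" for c
    by (rule sum_nonneg) (use assms(2) in force)
qed (use assms in auto)

section \<open>The exchanged intervals as tilings\<close>

lemma breakpt_pred:
  "j \<in> {1..r} \<Longrightarrow> breakpt l (j - 1) = sum l {i \<in> {1..r}. i < j}"
  unfolding breakpt_def by (rule sum.cong) auto

lemma breakpt_step:
  "1 \<le> j \<Longrightarrow> breakpt l j = breakpt l (j - 1) + l j"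
  by (cases j) (auto simp: breakpt_def)

lemma tiling_breakpt:
  assumes "iet_data r \<pi> l"
  shows "tiling {1..r} (\<lambda>j. breakpt l (j - 1)) l"
proof -
  have "tiling {1..r} (\<lambda>j. sum l {i \<in> {1..r}. i < j}) l"
    using tiling_of_order[of "{1..r}" l "\<lambda>i. i"] assms by (auto simp: iet_data_def)
  moreover have "breakpt l (j - 1) = sum l {i \<in> {1..r}. i < j}" if "j \<in> {1..r}" for j
    using that by (rule breakpt_pred)
  ultimately show ?thesis
    by (simp add: tiling_def del: One_nat_def)
qed

lemma interv_index_eqI:
  assumes "iet_data r \<pi> l" "j \<in> {1..r}" "x \<in> interv l j"
  shows "interv_index r l x = j"
proof -
  interpret tiling "{1..r}" "\<lambda>j. breakpt l (j - 1)" l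
    by (rule tiling_breakpt[OF assms(1)])
  show ?thesis
    unfolding interv_index_def
  proof (rule the_equality)
    show "j' = j" if "j' \<in> {1..r} \<and> x \<in> interv l j'" for j'
      using that assms(2,3) cell_unique[of j' j x] by (auto simp: interv_def breakpt_step)
  qed (use assms in simp)
qed

lemma interv_index_in:
  assumes "iet_data r \<pi> l" "x \<in> {0..<1}"
  shows "interv_index r l x \<in> {1..r}" "x \<in> interv l (interv_index r l x)"
proof -
  interpret tiling "{1..r}" "\<lambda>j. breakpt l (j - 1)" l
    by (rule tiling_breakpt[OF assms(1)])
  obtain j where "j \<in> {1..r}" "x \<in> interv l j"
    using covers[of x] assms(2) by (auto simp: interv_def breakpt_step)
  then show "interv_index r l x \<in> {1..r}" "x \<in> interv l (interv_index r l x)"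
    using interv_index_eqI[OF assms(1)] by auto
qed

text \<open>The cuts \<open>P\<close> are left endpoints, as the pieces are closed on the left.\<close>

definition piecewise_translation :: "(real \<Rightarrow> real) \<Rightarrow> bool" where
  "piecewise_translation f \<longleftrightarrow>
     (\<exists>P. finite P \<and>
        (\<forall>x y. 0 \<le> x \<longrightarrow> x \<le> y \<longrightarrow> y < 1 \<longrightarrow> {x<..y} \<inter> P = {} \<longrightarrow> f y - f x = y - x))"

lemma piecewise_translationI:
  assumes "finite P"
    and "\<And>x y. \<lbrakk>0 \<le> x; x \<le> y; y < 1; {x<..y} \<inter> P = {}\<rbrakk> \<Longrightarrow> f y - f x = y - x"
  shows "piecewise_translation f"
  using assms unfolding piecewise_translation_def by blast

lemma (in tiling) piecewise_translation_cells:
  assumes "\<And>c x. \<lbrakk>c \<in> C; s c \<le> x; x < s c + w c\<rbrakk> \<Longrightarrow> f x = s' c + (x - s c)"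
  shows "piecewise_translation f"
proof (rule piecewise_translationI)
  show "finite (s ` C)"
    using finite_C by simp
  fix x y :: real
  assume *: "0 \<le> x" "x \<le> y" "y < 1" "{x<..y} \<inter> s ` C = {}"
  obtain c where c: "c \<in> C" "s c \<le> y" "y < s c + w c"
    using covers[of y] * by auto
  then have "s c \<le> x"
    using * by (auto simp: disjoint_iff not_le)
  then show "f y - f x = y - x"
    using assms[of c x] assms[of c y] c * by simp
qed

lemma iet_shift:
  assumes "iet_data r \<pi> l" "j \<in> {1..r}" "x \<in> interv l j"
  shows "iet r \<pi> l x = sum l {i \<in> {1..r}. \<pi> i < \<pi> j} + (x - breakpt l (j - 1))"
proof -
  interpret tiling "{1..r}" "\<lambda>j. breakpt l (j - 1)" l
    by (rule tiling_breakpt[OF assms(1)])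
  have "x \<in> {0..<1}"
    using assms s_nonneg[of j] end_le_1[of j] by (auto simp: interv_def breakpt_step)
  then show ?thesis
    using interv_index_eqI[OF assms] breakpt_pred[OF assms(2)] by (simp add: iet_def Let_def)
qed

lemma tiling_image:
  assumes "iet_data r \<pi> l"
  shows "tiling {1..r} (\<lambda>j. sum l {i \<in> {1..r}. \<pi> i < \<pi> j}) l"
proof (rule tiling_of_order)
  show "inj_on \<pi> {1..r}"
    using assms permutes_inj[of \<pi>] by (auto simp: iet_data_def intro: inj_on_subset)
qed (use assms in \<open>simp_all add: iet_data_def\<close>)

text \<open>The translated intervals tile [0,1) again by \<open>tiling_image\<close>: uniqueness of
  the cell gives injectivity, coverage gives surjectivity.\<close>

lemma bij_betw_iet:
  assumes "iet_data r \<pi> l"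
  shows "bij_betw (iet r \<pi> l) {0..<1} {0..<1}"
proof -
  interpret dom: tiling "{1..r}" "\<lambda>j. breakpt l (j - 1)" l
    by (rule tiling_breakpt[OF assms])
  interpret im: tiling "{1..r}" "\<lambda>j. sum l {i \<in> {1..r}. \<pi> i < \<pi> j}" l
    by (rule tiling_image[OF assms])
  have ex: "\<exists>j\<in>{1..r}. x \<in> interv l j" if "x \<in> {0..<1}" for x
    using interv_index_in[OF assms that] by blast
  have inside: "sum l {i \<in> {1..r}. \<pi> i < \<pi> j} \<le> iet r \<pi> l x"
    "iet r \<pi> l x < sum l {i \<in> {1..r}. \<pi> i < \<pi> j} + l j"
    if "j \<in> {1..r}" "x \<in> interv l j" for j x
    using iet_shift[OF assms that] that by (auto simp: interv_def breakpt_step)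
  show ?thesis
    unfolding bij_betw_def
  proof (intro conjI subset_antisym subsetI inj_onI)
    fix x y assume xy: "x \<in> {0..<1}" "y \<in> {0..<1}" "iet r \<pi> l x = iet r \<pi> l y"
    obtain j k where jk: "j \<in> {1..r}" "x \<in> interv l j" "k \<in> {1..r}" "y \<in> interv l k"
      using ex xy(1,2) by blast
    then have "j = k"
      using im.cell_unique[of j k "iet r \<pi> l x"] inside[of j x] inside[of k y] xy(3) by simp
    then show "x = y"
      using iet_shift[OF assms, of j] jk xy(3) by simp
  next
    fix y assume "y \<in> iet r \<pi> l ` {0..<1}"
    then obtain x where "x \<in> {0..<1}" "y = iet r \<pi> l x" by blast
    then obtain j where "j \<in> {1..r}" "x \<in> interv l j"
      using ex by blast
    then show "y \<in> {0..<1}"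
      using inside[of j x] im.s_nonneg[of j] im.end_le_1[of j] \<open>y = _\<close> by simp
  next
    fix z :: real assume "z \<in> {0..<1}"
    then obtain j where j: "j \<in> {1..r}" "sum l {i \<in> {1..r}. \<pi> i < \<pi> j} \<le> z"
      "z < sum l {i \<in> {1..r}. \<pi> i < \<pi> j} + l j"
      using im.covers[of z] by auto
    define x where "x = breakpt l (j - 1) + (z - sum l {i \<in> {1..r}. \<pi> i < \<pi> j})"
    have x: "x \<in> interv l j"
      using j by (auto simp: x_def interv_def breakpt_step)
    moreover have "x \<in> {0..<1}"
      using x j dom.s_nonneg[of j] dom.end_le_1[of j] by (auto simp: interv_def breakpt_step)
    moreover have "z = iet r \<pi> l x"
      using iet_shift[OF assms j(1) x] by (simp add: x_def)
    ultimately show "z \<in> iet r \<pi> l ` {0..<1}"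
      by (intro image_eqI)
  qed
qed

text \<open>
  The interval with label \<open>c\<close> is numbered by the rank of \<open>s c\<close>, and the permutation sends it
  to the rank of \<open>s' c\<close>.
\<close>

lemma iet_of_tilings:
  assumes "tiling C s w" "tiling C s' w" "\<And>x. x \<notin> {0..<1} \<Longrightarrow> f x = x"
    and f: "\<And>c x. \<lbrakk>c \<in> C; s c \<le> x; x < s c + w c\<rbrakk> \<Longrightarrow> f x = s' c + (x - s c)"
  shows "f \<in> IETs"
proof -
  interpret S: tiling C s w by (rule assms)
  interpret S': tiling C s' w by (rule assms)
  define r where "r = card C"
  \<comment> \<open>The count includes \<open>c\<close> itself, so ranks run from 1 to
    \<open>r\<close>.\<close>
  define rank where "rank t c = card {c' \<in> C. t c' \<le> t c}" for t :: "'a \<Rightarrow> real" and c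
  have rank_mono: "rank t c < rank t c' \<longleftrightarrow> t c < t c'" if "c \<in> C" "c' \<in> C" for t c c'
  proof
    assume "t c < t c'"
    then have "{x \<in> C. t x \<le> t c} \<subseteq> {x \<in> C. t x \<le> t c'}"
      "c' \<notin> {x \<in> C. t x \<le> t c}" "c' \<in> {x \<in> C. t x \<le> t c'}"
      using that by auto
    then have "{x \<in> C. t x \<le> t c} \<subset> {x \<in> C. t x \<le> t c'}"
      by blast
    then show "rank t c < rank t c'"
      unfolding rank_def using S.finite_C by (intro psubset_card_mono) auto
  next
    assume *: "rank t c < rank t c'"
    show "t c < t c'"
    proof (rule ccontr)
      assume "\<not> t c < t c'"
      then have "rank t c' \<le> rank t c"
        unfolding rank_def using S.finite_C by (intro card_mono) auto
      then show False using * by simp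
    qed
  qed
  have bij: "bij_betw (rank t) C {1..r}" if "inj_on t C" for t
  proof -
    have inj: "inj_on (rank t) C"
      by (rule inj_onI) (metis less_irrefl linorder_neqE_linordered_idom rank_mono that inj_onD)
    moreover have "rank t ` C \<subseteq> {1..r}"
    proof clarify
      fix c assume "c \<in> C"
      then have "0 < card {c' \<in> C. t c' \<le> t c}"
        using S.finite_C by (auto simp: card_gt_0_iff)
      moreover have "card {c' \<in> C. t c' \<le> t c} \<le> r"
        unfolding r_def using S.finite_C by (intro card_mono) auto
      ultimately show "rank t c \<in> {1..r}" by (simp add: rank_def)
    qed
    ultimately show ?thesis
      unfolding bij_betw_def by (auto simp: r_def card_image card_subset_eq)
  qed
  note bs = bij[OF S.inj_on_s] and bs' = bij[OF S'.inj_on_s]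
  define e where "e = inv_into C (rank s)"
  have e: "bij_betw e {1..r} C"
    unfolding e_def by (rule bij_betw_inv_into[OF bs])
  have e_rank: "e (rank s c) = c" if "c \<in> C" for c
    unfolding e_def using bs that by (simp add: bij_betw_def)
  have rank_e: "rank s (e i) = i" if "i \<in> {1..r}" for i
    unfolding e_def using bs that by (simp add: bij_betw_def f_inv_into_f)
  define \<pi> where "\<pi> i = (if i \<in> {1..r} then rank s' (e i) else i)" for i
  define l where "l = w \<circ> e"
  have "bij_betw (rank s' \<circ> e) {1..r} {1..r}"
    using e bs' by (rule bij_betw_trans)
  then have "bij_betw \<pi> {1..r} {1..r}"
    using bij_betw_cong[of "{1..r}" \<pi> "rank s' \<circ> e" "{1..r}"] by (simp add: \<pi>_def)
  then have "\<pi> permutes {1..r}"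
    by (rule bij_imp_permutes) (auto simp: \<pi>_def)
  moreover have "sum l {1..r} = 1"
    unfolding l_def using sum.reindex_bij_betw[OF e, of w] S.sum_w by simp
  moreover have "C \<noteq> {}"
    using S.sum_w by auto
  then have "1 \<le> r"
    using S.finite_C by (simp add: r_def Suc_le_eq card_gt_0_iff)
  moreover have "0 < l i" if "i \<in> {1..r}" for i
    using S.w_pos e that by (auto simp: l_def bij_betw_def)
  ultimately have data: "iet_data r \<pi> l"
    by (simp add: iet_data_def)
  \<comment> \<open>Reindexing along \<open>e\<close> turns the sums that define \<open>iet\<close>
    into sums of widths of cells further left, which \<open>sum_before\<close> evaluates as
    \<open>s c\<close> and \<open>s' c\<close>.\<close>
  have sum_l: "sum l {i \<in> {1..r}. Q (e i)} = sum w {c \<in> C. Q c}" for Q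
  proof -
    have "e ` {i \<in> {1..r}. Q (e i)} = {c \<in> C. Q c}"
      using bij_betw_imp_surj_on[OF e] by blast
    then have "bij_betw e {i \<in> {1..r}. Q (e i)} {c \<in> C. Q c}"
      by (rule bij_betw_subset[OF e, rotated]) blast
    then have "(\<Sum>i\<in>{i \<in> {1..r}. Q (e i)}. w (e i)) = sum w {c \<in> C. Q c}"
      by (rule sum.reindex_bij_betw)
    then show ?thesis
      by (simp only: l_def o_def)
  qed
  have "f x = iet r \<pi> l x" for x
  proof (cases "x \<in> {0..<1}")
    case True
    then obtain c where c: "c \<in> C" "s c \<le> x" "x < s c + w c"
      using S.covers[of x] by auto
    define j where "j = rank s c"
    have j: "j \<in> {1..r}" "e j = c"
      using bij_betwE[OF bs] c(1) e_rank by (auto simp: j_def)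
    have "i < j \<longleftrightarrow> s (e i) < s c" "\<pi> i < \<pi> j \<longleftrightarrow> s' (e i) < s' c" if "i \<in> {1..r}" for i
      using that rank_mono[of "e i" c s] rank_mono[of "e i" c s'] rank_e[OF that] bij_betwE[OF e] c(1) j
      by (auto simp: \<pi>_def j_def)
    then have lt: "{i \<in> {1..r}. i < j} = {i \<in> {1..r}. s (e i) < s c}"
      and lt': "{i \<in> {1..r}. \<pi> i < \<pi> j} = {i \<in> {1..r}. s' (e i) < s' c}"
      by blast+
    have b: "breakpt l (j - 1) = s c"
      using sum_l[of "\<lambda>c'. s c' < s c"] S.sum_before[OF c(1)] breakpt_pred[OF j(1)] lt by metis
    have b': "sum l {i \<in> {1..r}. \<pi> i < \<pi> j} = s' c"
      using sum_l[of "\<lambda>c'. s' c' < s' c"] S'.sum_before[OF c(1)] lt' by metis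
    have "x \<in> interv l j"
      using b c j by (auto simp: interv_def breakpt_step l_def)
    then show ?thesis
      using iet_shift[OF data j(1)] b b' f[OF c] by simp
  qed (auto simp: iet_def assms(3))
  then have "f = iet r \<pi> l" by blast
  then show ?thesis
    using data by (auto simp: IETs_def)
qed

section \<open>A criterion for being an interval exchange\<close>

text \<open>Each summand is the gap from \<open>c\<close> to its successor, with \<open>b\<close>
  following the last point. A new maximum \<open>m\<close> becomes the right end for the old points,
  hence the induction over arbitrary \<open>b\<close>.\<close>

lemma sum_gaps:
  fixes a b :: real
  assumes "finite A" "A \<subseteq> {a<..<b}" "a < b"
  shows "(\<Sum>c\<in>insert a A. Min (insert b {c' \<in> insert a A. c < c'}) - c) = b - a"
  using assms
proof (induction A arbitrary: b rule: finite_linorder_max_induct)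
  case empty
  have no_gap: "{c' \<in> insert a {}. a < c'} = {}"
    by auto
  show ?case
    using empty by (simp add: no_gap del: insert_iff)
next
  case (insert m A)
  have "Min (insert b {c' \<in> insert a (insert m A). c < c'})
      = Min (insert m {c' \<in> insert a A. c < c'})" if "c \<in> insert a A" for c
  proof -
    have "c < m"
      using that insert by auto
    then have "{c' \<in> insert a (insert m A). c < c'} = insert m {c' \<in> insert a A. c < c'}"
      by auto
    moreover have "Min (insert m {c' \<in> insert a A. c < c'}) \<le> m"
      using insert by simp
    ultimately show ?thesis
      using insert by (simp add: min_def)
  qed
  then have "(\<Sum>c\<in>insert a A. Min (insert b {c' \<in> insert a (insert m A). c < c'}) - c) = m - a"
    using insert by (subst insert.IH[of m, symmetric]) auto
  moreover have "Min (insert b {c' \<in> insert a (insert m A). m < c'}) = b"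
  proof -
    have "{c' \<in> insert a (insert m A). m < c'} = {}"
      using insert by auto
    then show ?thesis by (simp only:) simp
  qed
  moreover have "m \<notin> insert a A"
    using insert by auto
  moreover have "insert a (insert m A) = insert m (insert a A)"
    by auto
  ultimately show ?case
    using insert.hyps(1) by (simp only: sum.insert finite_insert not_False_eq_True)
qed

text \<open>The cuts divide [0,1) into cells that \<open>f\<close> translates. Injectivity keeps the
  translated cells disjoint, and their total width is still 1, so they form the second tiling that
  \<open>iet_of_tilings\<close> requires.\<close>

lemma IETs_I:
  assumes id: "\<And>x. x \<notin> {0..<1} \<Longrightarrow> f x = x"
    and into: "f ` {0..<1} \<subseteq> {0..<1}" and inj: "inj_on f {0..<1}"
    and pw: "piecewise_translation f"
  shows "f \<in> IETs"
proof -
  obtain P where P: "finite P"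
    "\<And>x y. \<lbrakk>0 \<le> x; x \<le> y; y < 1; {x<..y} \<inter> P = {}\<rbrakk> \<Longrightarrow> f y - f x = y - x"
    using pw unfolding piecewise_translation_def by metis
  define C where "C = insert 0 (P \<inter> {0..<1})"
  have C: "finite C" "0 \<in> C" "C \<subseteq> {0..<1}"
    using P(1) by (auto simp: C_def)
  define nxt where "nxt c = Min (insert 1 {c' \<in> C. c < c'})" for c
  have nxt_gt: "c < nxt c" if "c \<in> C" for c
    using C that unfolding nxt_def by (subst Min_gr_iff) auto
  have nxt_le: "nxt c \<le> c'" if "c' \<in> C" "c < c'" for c c'
    using C that by (simp add: nxt_def)
  have nxt_le1: "nxt c \<le> 1" for c
    using C by (simp add: nxt_def)
  have tr: "f x = f c + (x - c)" if "c \<in> C" "c \<le> x" "x < nxt c" for c x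
  proof -
    have "{c<..x} \<inter> P = {}"
    proof (rule ccontr)
      assume "\<not> ?thesis"
      then obtain p where p: "p \<in> P" "c < p" "p \<le> x" by auto
      then have "p \<in> C"
        using that C(3) nxt_le1[of c] by (auto simp: C_def)
      then show False
        using nxt_le[of p c] p that by simp
    qed
    then have "f x - f c = x - c"
      using P(2)[of c x] that C(3) nxt_le1[of c] by auto
    then show ?thesis by simp
  qed
  have dj: "nxt c \<le> c' \<or> nxt c' \<le> c" if "c \<in> C" "c' \<in> C" "c \<noteq> c'" for c c'
    using nxt_le that by (metis linorder_neqE_linordered_idom)
  have f_in: "f c \<in> {0..<1}" if "c \<in> {0..<1}" for c
    using into that by blast
  have sum1: "(\<Sum>c\<in>C. nxt c - c) = 1"
    using sum_gaps[of "P \<inter> {0..<1} - {0}" 0 1] P(1)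
    by (simp add: nxt_def C_def subset_iff)
  have "tiling C (\<lambda>c. c) (\<lambda>c. nxt c - c)"
    by standard (use C nxt_gt nxt_le1 dj sum1 in auto)
  moreover have "tiling C f (\<lambda>c. nxt c - c)"
  proof
    fix c assume c: "c \<in> C"
    have fc: "0 \<le> f c" "f c < 1" and c01: "0 \<le> c"
      using f_in[of c] C(3) c by auto
    then show "0 \<le> f c" by simp
    show "f c + (nxt c - c) \<le> 1"
    proof (rule ccontr)
      assume gt: "\<not> ?thesis"
      \<comment> \<open>If the translated cell reached beyond 1, this point of the cell would be
        sent to 1, outside [0,1).\<close>
      then have "f (c + (1 - f c)) = 1"
        using tr[OF c, of "c + (1 - f c)"] fc by simp
      moreover have "c + (1 - f c) \<in> {0..<1}"
        using c01 nxt_le1[of c] fc gt by simp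
      ultimately show False
        using f_in[of "c + (1 - f c)"] by simp
    qed
    fix c' assume c': "c' \<in> C" "c \<noteq> c'"
    show "f c + (nxt c - c) \<le> f c' \<or> f c' + (nxt c' - c') \<le> f c"
    proof (rule ccontr)
      assume "\<not> ?thesis"
      \<comment> \<open>The larger of the two left ends lies in both translated cells, so it has a
        preimage in each.\<close>
      moreover define z where "z = max (f c) (f c')"
      ultimately have z: "f c \<le> z" "z < f c + (nxt c - c)" "f c' \<le> z" "z < f c' + (nxt c' - c')"
        using nxt_gt[OF c] nxt_gt[OF c'(1)] by (auto simp: max_def)
      let ?x = "c + (z - f c)" and ?y = "c' + (z - f c')"
      have "f ?x = z" "f ?y = z"
        using tr[OF c, of ?x] tr[OF c'(1), of ?y] z by auto
      moreover have "?x \<in> {0..<1}" "?y \<in> {0..<1}"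
        using c01 subsetD[OF C(3) c'(1)] z nxt_le1[of c] nxt_le1[of c'] by auto
      ultimately have "?x = ?y"
        using inj inj_onD[of f "{0..<1}" ?x ?y] by simp
      then show False
        using dj[OF c c'] z by (smt (verit))
    qed
  next
    show "0 < nxt c - c" if "c \<in> C" for c
      using nxt_gt[OF that] by simp
  qed (fact C(1) sum1)+
  ultimately show ?thesis
    using id
  proof (rule iet_of_tilings)
    show "f x = f c + (x - c)" if "c \<in> C" "c \<le> x" "x < c + (nxt c - c)" for c x
      using tr[of c x] that by simp
  qed
qed

subsection \<open>The group of interval exchanges\<close>

lemma
  assumes "f \<in> IETs"
  shows IETs_outside: "x \<notin> {0..<1} \<Longrightarrow> f x = x"
    and IETs_bij_betw: "bij_betw f {0..<1} {0..<1}"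
    and IETs_piecewise_translation: "piecewise_translation f"
proof -
  obtain r \<pi> l where f: "iet_data r \<pi> l" "f = iet r \<pi> l"
    using assms unfolding IETs_def by blast
  show "x \<notin> {0..<1} \<Longrightarrow> f x = x"
    unfolding f(2) iet_def by auto
  show "bij_betw f {0..<1} {0..<1}"
    unfolding f(2) by (rule bij_betw_iet[OF f(1)])
  interpret tiling "{1..r}" "\<lambda>j. breakpt l (j - 1)" l
    by (rule tiling_breakpt[OF f(1)])
  show "piecewise_translation f"
  proof (rule piecewise_translation_cells)
    show "f x = sum l {i \<in> {1..r}. \<pi> i < \<pi> j} + (x - breakpt l (j - 1))"
      if "j \<in> {1..r}" "breakpt l (j - 1) \<le> x" "x < breakpt l (j - 1) + l j" for j x
      unfolding f(2) using iet_shift[OF f(1) that(1), of x] that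
      by (auto simp: interv_def breakpt_step)
  qed
qed

lemma IETs_bij:
  assumes "f \<in> IETs"
  shows "bij f"
proof -
  have "bij_betw f (- {0..<1}) (- {0..<1})"
    by (rule bij_betw_cong[THEN iffD1, OF _ bij_betw_id]) (simp add: IETs_outside[OF assms])
  then have "bij_betw f ({0..<1} \<union> - {0..<1}) ({0..<1} \<union> - {0..<1})"
    using IETs_bij_betw[OF assms] by (intro bij_betw_combine) auto
  then show ?thesis
    by (simp only: Compl_partition)
qed

lemma IETs_in: "f \<in> IETs \<Longrightarrow> f x \<in> {0..<1} \<longleftrightarrow> x \<in> {0..<1}"
  using IETs_bij_betw[of f] IETs_outside[of f x] bij_betwE by metis

text \<open>The composition can break only at a cut of \<open>f\<close> or at a point that
  \<open>f\<close> sends to a cut of \<open>g\<close>; the latter are finitely many because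
  \<open>f\<close> is injective.\<close>

lemma IETs_comp:
  assumes f: "f \<in> IETs" and g: "g \<in> IETs"
  shows "g \<circ> f \<in> IETs"
proof (rule IETs_I)
  obtain P where P: "finite P"
    "\<And>x y. \<lbrakk>0 \<le> x; x \<le> y; y < 1; {x<..y} \<inter> P = {}\<rbrakk> \<Longrightarrow> f y - f x = y - x"
    using IETs_piecewise_translation[OF f] unfolding piecewise_translation_def by metis
  obtain Q where Q: "finite Q"
    "\<And>x y. \<lbrakk>0 \<le> x; x \<le> y; y < 1; {x<..y} \<inter> Q = {}\<rbrakk> \<Longrightarrow> g y - g x = y - x"
    using IETs_piecewise_translation[OF g] unfolding piecewise_translation_def by metis
  show "piecewise_translation (g \<circ> f)"
  proof (rule piecewise_translationI)
    show "finite (P \<union> f -` Q)"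
      using P(1) Q(1) IETs_bij[OF f] by (simp add: finite_vimageI bij_is_inj)
    fix x y :: real
    assume *: "0 \<le> x" "x \<le> y" "y < 1" "{x<..y} \<inter> (P \<union> f -` Q) = {}"
    have fz: "f z - f x = z - x" if "z \<in> {x..y}" for z
    proof (rule P(2))
      show "{x<..z} \<inter> P = {}"
        using *(4) that by (auto simp: disjoint_iff)
    qed (use * that in auto)
    have "{f x<..f y} \<inter> Q = {}"
    proof (rule ccontr)
      assume "\<not> ?thesis"
      then obtain q where q: "q \<in> Q" "f x < q" "q \<le> f y"
        by auto
      \<comment> \<open>Without a cut of \<open>f\<close> in between, its values sweep the whole
        interval from \<open>f x\<close> to \<open>f y\<close>, so \<open>q\<close> is attained at
        \<open>z\<close>.\<close>
      define z where "z = x + (q - f x)"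
      have "z \<in> {x<..y}"
        using q fz[of y] * by (auto simp: z_def)
      moreover from this have "f z = q"
        using fz[of z] by (simp add: z_def)
      ultimately show False
        using *(4) q(1) by auto
    qed
    then have "g (f y) - g (f x) = f y - f x"
      using Q(2)[of "f x" "f y"] IETs_in[OF f, of x] IETs_in[OF f, of y] fz[of y] * by simp
    then show "(g \<circ> f) y - (g \<circ> f) x = y - x"
      using fz[of y] * by simp
  qed
  have "bij_betw (g \<circ> f) {0..<1} {0..<1}"
    using IETs_bij_betw[OF f] IETs_bij_betw[OF g] by (rule bij_betw_trans)
  then show "(g \<circ> f) ` {0..<1} \<subseteq> {0..<1}" "inj_on (g \<circ> f) {0..<1}"
    unfolding bij_betw_def by simp_all
qed (simp add: IETs_outside f g)

text \<open>The pieces of the inverse are the images of the pieces of \<open>f\<close>, so its cuts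
  are the \<open>f\<close>-images of their left ends.\<close>

lemma IETs_inv:
  assumes f: "f \<in> IETs"
  shows "inv f \<in> IETs"
proof (rule IETs_I)
  note inv = bij_inv_eq_iff[OF IETs_bij[OF f]]
  obtain P where P: "finite P"
    "\<And>x y. \<lbrakk>0 \<le> x; x \<le> y; y < 1; {x<..y} \<inter> P = {}\<rbrakk> \<Longrightarrow> f y - f x = y - x"
    using IETs_piecewise_translation[OF f] unfolding piecewise_translation_def by metis
  have inv_in: "inv f x \<in> {0..<1}" if "x \<in> {0..<1}" for x
    using IETs_in[OF f, of "inv f x"] that inv by metis
  show "piecewise_translation (inv f)"
  proof (rule piecewise_translationI)
    define C where "C = insert 0 (P \<inter> {0..<1})"
    have C: "finite C" "0 \<in> C" "C \<subseteq> {0..<1}"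
      using P(1) by (auto simp: C_def)
    show "finite (f ` C)"
      using C(1) by simp
    fix x y :: real
    assume *: "0 \<le> x" "x \<le> y" "y < 1" "{x<..y} \<inter> f ` C = {}"
    define v where "v = inv f y"
    have v: "f v = y" "0 \<le> v" "v < 1"
      using surj_f_inv_f[OF bij_is_surj[OF IETs_bij[OF f]]] inv_in[of y] * by (simp_all add: v_def)
    \<comment> \<open>Left end of the piece of \<open>f\<close> containing \<open>inv f y\<close>.
      The image of this piece starts at \<open>f c\<close>; since \<open>f c\<close> is not in
      \<open>{x<..y}\<close>, the point \<open>x\<close> lies in the same image.\<close>
    define c where "c = Max {c \<in> C. c \<le> v}"
    have ne: "finite {c \<in> C. c \<le> v}" "{c \<in> C. c \<le> v} \<noteq> {}"
      using C v by auto
    have c: "c \<in> C" "c \<le> v"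
      using Max_in[OF ne] by (auto simp: c_def)
    have c_max: "p \<le> c" if "p \<in> C" "p \<le> v" for p
      using Max_ge[OF ne(1), of p] that by (simp add: c_def)
    have tr: "f z - f c = z - c" if "c \<le> z" "z \<le> v" for z
    proof (rule P(2))
      have "p \<le> c" if "p \<in> P" "c < p" "p \<le> z" for p
        using c_max[of p] that \<open>z \<le> v\<close> v C(3) c(1) by (auto simp: C_def)
      then show "{c<..z} \<inter> P = {}"
        by force
    qed (use C(3) c(1) v that in auto)
    have "f c \<le> y"
      using tr[of v] c v by simp
    then have "f c \<le> x"
      using *(4) c(1) by (meson disjoint_iff greaterThanAtMost_iff imageI not_le)
    then have "f (c + (x - f c)) = x"
      using tr[of "c + (x - f c)"] tr[of v] c v * by simp
    then have "inv f x = c + (x - f c)"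
      by (rule inv_f_eq[OF bij_is_inj[OF IETs_bij[OF f]]])
    then show "inv f y - inv f x = y - x"
      using tr[of v] c v by (simp add: v_def)
  qed
  show "inv f ` {0..<1} \<subseteq> {0..<1}"
    using inv_in by blast
  show "inj_on (inv f) {0..<1}"
    using bij_imp_bij_inv[OF IETs_bij[OF f]] by (auto intro: inj_on_subset bij_is_inj)
  show "inv f x = x" if "x \<notin> {0..<1}" for x
    using IETs_outside[OF f that] by (rule inv_f_eq[OF bij_is_inj[OF IETs_bij[OF f]]])
qed

lemma conj_funpow:
  assumes "bij g"
  shows "(g \<circ> f \<circ> inv g) ^^ k = g \<circ> f ^^ k \<circ> inv g"
proof (induction k)
  case 0
  show ?case
    using bij_is_surj[OF assms] by (simp add: surj_iff)
next
  case (Suc k)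
  have "inv g (g x) = x" for x
    using assms by (simp add: bij_is_inj)
  then show ?case
    unfolding funpow.simps Suc.IH by (simp add: fun_eq_iff)
qed

lemma conjugateI:
  assumes "g \<in> IETs" "g \<circ> S = T \<circ> g"
  shows "conjugate S T"
  unfolding conjugate_def
proof (rule bexI[OF _ assms(1)])
  have "g \<circ> inv g = id"
    using bij_is_surj[OF IETs_bij[OF assms(1)]] surj_iff by blast
  then show "T = g \<circ> S \<circ> inv g"
    using assms(2) by (simp add: comp_assoc)
qed

lemma conjugate_sym:
  assumes "conjugate S T"
  shows "conjugate T S"
proof -
  obtain g where g: "g \<in> IETs" "T = g \<circ> S \<circ> inv g"
    using assms unfolding conjugate_def by blast
  note b = IETs_bij[OF g(1)]
  show ?thesis
  proof (rule conjugateI[OF IETs_inv[OF g(1)]])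
    show "inv g \<circ> T = S \<circ> inv g"
      using b by (simp add: g(2) fun_eq_iff bij_is_inj)
  qed
qed

lemma conjugate_trans:
  assumes "conjugate S T" "conjugate T U"
  shows "conjugate S U"
proof -
  obtain g h where g: "g \<in> IETs" "T = g \<circ> S \<circ> inv g" and h: "h \<in> IETs" "U = h \<circ> T \<circ> inv h"
    using assms unfolding conjugate_def by blast
  show ?thesis
  proof (rule conjugateI[OF IETs_comp[OF g(1) h(1)]])
    show "h \<circ> g \<circ> S = U \<circ> (h \<circ> g)"
      using IETs_bij[OF g(1)] IETs_bij[OF h(1)] by (simp add: g(2) h(2) fun_eq_iff bij_is_inj)
  qed
qed

lemma has_root_conjugate:
  assumes "conjugate S T" "has_root p S"
  shows "has_root p T"
proof -
  obtain g R where g: "g \<in> IETs" "T = g \<circ> S \<circ> inv g" and R: "R \<in> IETs" "S = R ^^ p"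
    using assms unfolding conjugate_def has_root_def by blast
  have "T = (g \<circ> R \<circ> inv g) ^^ p"
    using conj_funpow[OF IETs_bij[OF g(1)]] g(2) R(2) by simp
  moreover have "g \<circ> R \<circ> inv g \<in> IETs"
    by (intro IETs_comp IETs_inv g R)
  ultimately show ?thesis
    unfolding has_root_def by blast
qed

subsection \<open>Shifts of a cylinder\<close>

text \<open>\<open>frac\<close> drops only at integers: if the floors of \<open>u + e\<close> and
  \<open>v + e\<close> differed, then \<open>\<lfloor>v + e\<rfloor> - e\<close> would be a point in
  between where the fractional part vanishes.\<close>

lemma frac_diff_no_wrap:
  fixes u v e :: real
  assumes "u \<le> v" "\<And>w. \<lbrakk>u < w; w \<le> v\<rbrakk> \<Longrightarrow> frac (w + e) \<noteq> 0"
  shows "frac (v + e) - frac (u + e) = v - u"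
proof -
  have "\<lfloor>u + e\<rfloor> = \<lfloor>v + e\<rfloor>"
  proof (rule ccontr)
    assume ne: "\<not> ?thesis"
    have "\<lfloor>u + e\<rfloor> \<le> \<lfloor>v + e\<rfloor>"
      using assms(1) by (intro floor_mono) simp
    then have "\<lfloor>u + e\<rfloor> < \<lfloor>v + e\<rfloor>"
      using ne by simp
    then have "u < of_int \<lfloor>v + e\<rfloor> - e" "of_int \<lfloor>v + e\<rfloor> - e \<le> v"
      by linarith+
    then show False
      using assms(2)[of "of_int \<lfloor>v + e\<rfloor> - e"] by simp
  qed
  then show ?thesis
    by (simp add: frac_def)
qed

text \<open>
  The tower of constant height \<open>d\<close> over the rotation by \<open>\<theta>\<close> is \<open>cyl_shift d \<theta> 0 1\<close>; the
  point \<open>x\<close> on level \<open>n + 1\<close> sits at \<open>(n + x) / d\<close>. Moving up \<open>j\<close> levels and shifting the circle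
  coordinate by \<open>t\<close> is an action of the abelian group of all \<open>(t, j)\<close>, in which
  \<open>(-\<theta>, d)\<close> acts trivially.
\<close>

definition cyl_shift :: "nat \<Rightarrow> real \<Rightarrow> real \<Rightarrow> int \<Rightarrow> real \<Rightarrow> real" where
  "cyl_shift d \<theta> t j y =
     (if y \<in> {0..<1}
      then let n = \<lfloor>real d * y\<rfloor> + j in
        (of_int (n mod int d) + frac (frac (real d * y) + t + \<theta> * of_int (n div int d))) / real d
      else y)"

context
  fixes d :: nat
  assumes d: "0 < d"
begin

lemma cyl_coords:
  assumes "y \<in> {0..<1}"
  obtains n x where "0 \<le> n" "n < int d" "0 \<le> x" "x < 1" "y = (of_int n + x) / real d"
proof
  show "0 \<le> \<lfloor>real d * y\<rfloor>"
    using assms by simp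
  show "\<lfloor>real d * y\<rfloor> < int d"
    using assms d by (simp add: floor_less_iff)
  show "y = (of_int \<lfloor>real d * y\<rfloor> + frac (real d * y)) / real d"
    using d by (simp add: frac_def)
qed (simp_all add: frac_lt_1)

lemma cyl_point_in:
  assumes "0 \<le> n" "n < int d" "0 \<le> x" "x < 1"
  shows "(of_int n + x) / real d \<in> {0..<1}"
proof -
  have "real_of_int n + 1 \<le> real d"
    using assms(2) by linarith
  then show ?thesis
    using assms d by (simp add: field_simps)
qed

lemma cyl_shift_point:
  assumes "0 \<le> n" "n < int d" "0 \<le> x" "x < 1"
  shows "cyl_shift d \<theta> t j ((of_int n + x) / real d) =
    (of_int ((n + j) mod int d) + frac (x + t + \<theta> * of_int ((n + j) div int d))) / real d"
proof -
  have "\<lfloor>of_int n + x\<rfloor> = n" "frac (of_int n + x) = x"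
    using assms by (auto simp: floor_unique frac_eq)
  then show ?thesis
    using cyl_point_in[OF assms] d by (simp add: cyl_shift_def Let_def)
qed

lemma cyl_shift_in: "y \<in> {0..<1} \<Longrightarrow> cyl_shift d \<theta> t j y \<in> {0..<1}"
  using d by (auto elim!: cyl_coords intro!: cyl_point_in simp: cyl_shift_point frac_lt_1 simp del: atLeastLessThan_iff)

text \<open>Carries add up: the passages over the top in the inner and in the outer move together
  are those of the combined move, and each passage adds \<theta> to the circle coordinate.\<close>

lemma cyl_shift_add:
  "cyl_shift d \<theta> t j (cyl_shift d \<theta> t' j' y) = cyl_shift d \<theta> (t + t') (j + j') y"
proof (cases "y \<in> {0..<1}")
  case True
  then obtain n x where y: "0 \<le> n" "n < int d" "0 \<le> x" "x < 1" "y = (of_int n + x) / real d"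
    by (rule cyl_coords)
  have m: "(n + j') mod int d + j = n + (j + j') + (- ((n + j') div int d)) * int d"
    by (simp add: algebra_simps minus_div_mult_eq_mod[symmetric])
  have 1: "((n + j') mod int d + j) mod int d = (n + (j + j')) mod int d"
    unfolding mod_add_left_eq by (simp add: ac_simps)
  have 2: "((n + j') mod int d + j) div int d = (n + (j + j')) div int d - (n + j') div int d"
    unfolding m using d by (subst div_mult_self1) auto
  have 3: "frac (frac (x + t' + \<theta> * of_int ((n + j') div int d)) + t
      + \<theta> * of_int (((n + j') mod int d + j) div int d))
    = frac (x + (t + t') + \<theta> * of_int ((n + (j + j')) div int d))"
    unfolding 2 add.assoc frac_add_simps by (simp add: algebra_simps)
  show ?thesis
    unfolding y(5) cyl_shift_point[OF y(1-4)]
    by (subst cyl_shift_point) (use d 1 3 in \<open>simp_all add: frac_lt_1\<close>)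
qed (simp only: cyl_shift_def if_False)

lemma cyl_shift_0: "cyl_shift d \<theta> 0 0 y = y"
proof (cases "y \<in> {0..<1}")
  case True
  then obtain n x where y: "0 \<le> n" "n < int d" "0 \<le> x" "x < 1" "y = (of_int n + x) / real d"
    by (rule cyl_coords)
  show ?thesis
    unfolding y(5) cyl_shift_point[OF y(1-4)] using y(1-4) by (simp add: frac_eq)
qed (simp only: cyl_shift_def if_False)

text \<open>The relation that makes \<open>(-\<theta>, d)\<close> act trivially: \<open>d\<close>
  levels amount to one base rotation.\<close>

lemma cyl_shift_wrap: "cyl_shift d \<theta> t (j + int d) = cyl_shift d \<theta> (t + \<theta>) j"
proof
  fix y
  define n where "n = \<lfloor>real d * y\<rfloor> + j"
  have "\<lfloor>real d * y\<rfloor> + (j + int d) = n + int d"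
    by (simp add: n_def)
  moreover have "(n + int d) mod int d = n mod int d" "(n + int d) div int d = n div int d + 1"
    using d by simp_all
  moreover have "x + t + \<theta> * of_int (q + 1) = x + (t + \<theta>) + \<theta> * of_int q" for x q
    by (simp add: algebra_simps)
  ultimately show "cyl_shift d \<theta> t (j + int d) y = cyl_shift d \<theta> (t + \<theta>) j y"
    unfolding cyl_shift_def Let_def n_def[symmetric] by (simp only:)
qed

lemma cyl_shift_funpow: "cyl_shift d \<theta> t j ^^ k = cyl_shift d \<theta> (real k * t) (int k * j)"
  by (induction k) (auto simp: fun_eq_iff cyl_shift_0 cyl_shift_add algebra_simps)

lemma inv_cyl_shift: "inv (cyl_shift d \<theta> t j) = cyl_shift d \<theta> (- t) (- j)"
  by (rule inv_unique_comp) (simp_all add: fun_eq_iff cyl_shift_add cyl_shift_0)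

text \<open>Breaks occur where a level begins or where the shifted circle coordinate passes 0. In
  the latter case the image is the left end of a level, so \<open>F\<close> and its preimage contain
  all cuts.\<close>

lemma cyl_shift_IETs: "cyl_shift d \<theta> t j \<in> IETs"
proof (rule IETs_I)
  let ?V = "cyl_shift d \<theta> t j"
  have inj: "inj ?V"
    by (rule inj_on_inverseI[where g = "cyl_shift d \<theta> (- t) (- j)"])
      (simp add: cyl_shift_add cyl_shift_0)
  then show "inj_on ?V {0..<1}"
    by (rule inj_on_subset) simp
  show "?V ` {0..<1} \<subseteq> {0..<1}"
    using cyl_shift_in by blast
  show "?V x = x" if "x \<notin> {0..<1}" for x
    using that by (auto simp: cyl_shift_def)
  define F where "F = (\<lambda>k. of_int k / real d) ` {0..int d}"
  have F: "finite F"
    by (simp add: F_def)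
  show "piecewise_translation ?V"
  proof (rule piecewise_translationI)
    show "finite (F \<union> ?V -` F)"
      using F inj by (simp add: finite_vimageI)
    fix x y :: real
    assume *: "0 \<le> x" "x \<le> y" "y < 1" "{x<..y} \<inter> (F \<union> ?V -` F) = {}"
    obtain n u where x: "0 \<le> n" "n < int d" "0 \<le> u" "u < 1" "x = (of_int n + u) / real d"
      using cyl_coords[of x] * by auto
    obtain m v where y: "0 \<le> m" "m < int d" "0 \<le> v" "v < 1" "y = (of_int m + v) / real d"
      using cyl_coords[of y] * by auto
    have le: "of_int n + u \<le> of_int m + v"
      using *(2) d by (simp add: x(5) y(5) divide_le_cancel)
    have "m = n"
    proof (rule ccontr)
      assume "m \<noteq> n"
      then have "n < m"
        using le x y by linarith
      then have "of_int n + u < of_int m"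
        using x(4) by linarith
      then have "of_int m / real d \<in> {x<..y}"
        using d y(3) by (simp add: x(5) y(5) divide_simps)
      moreover have "of_int m / real d \<in> F"
        unfolding F_def using y by simp
      ultimately show False
        using *(4) by blast
    qed
    let ?e = "t + \<theta> * of_int ((n + j) div int d)"
    have "frac (v + ?e) - frac (u + ?e) = v - u"
    proof (rule frac_diff_no_wrap)
      show "u \<le> v"
        using le \<open>m = n\<close> by simp
      fix w assume w: "u < w" "w \<le> v"
      let ?z = "(of_int n + w) / real d"
      have "?z \<in> {x<..y}"
        using w d by (simp add: x(5) y(5) \<open>m = n\<close> divide_strict_right_mono divide_right_mono)
      then have "?V ?z \<notin> F"
        using *(4) by blast
      moreover have "?V ?z \<in> F" if "frac (w + ?e) = 0"
      proof -
        have "?V ?z = of_int ((n + j) mod int d) / real d"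
          using cyl_shift_point[of n w \<theta> t j] x y w that by (simp add: add.assoc)
        moreover have "(n + j) mod int d \<in> {0..int d}"
          using d by (simp add: less_imp_le)
        ultimately show ?thesis
          unfolding F_def by (rule image_eqI)
      qed
      ultimately show "frac (w + ?e) \<noteq> 0"
        by blast
    qed
    then show "?V y - ?V x = y - x"
      using cyl_shift_point[OF x(1-4)] cyl_shift_point[OF y(1-4)] x(5) y(5) \<open>m = n\<close>
      by (simp add: add.assoc diff_divide_distrib[symmetric])
  qed
qed

text \<open>The power of the shifted map is the action of \<open>(-\<theta>, d + 1)\<close>, which
  the wrap relation reduces to \<open>(0, 1)\<close>. The order \<open>d + 1\<close> is at least 2
  even when \<open>d = 1\<close>.\<close>

lemma has_root_cyl_shift: "has_root (d + 1) (cyl_shift d \<theta> 0 1)"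
proof -
  have "cyl_shift d \<theta> (- \<theta> / real (d + 1)) 1 ^^ (d + 1) = cyl_shift d \<theta> (- \<theta>) (1 + int d)"
  proof -
    have "real (d + 1) * (- \<theta> / real (d + 1)) = - \<theta>"
      by simp
    then show ?thesis
      unfolding cyl_shift_funpow by (simp only:) simp
  qed
  also have "\<dots> = cyl_shift d \<theta> 0 1"
    unfolding cyl_shift_wrap by simp
  finally show ?thesis
    unfolding has_root_def using cyl_shift_IETs by metis
qed

end

subsection \<open>Towers\<close>

locale tower_data =
  fixes r :: nat and \<pi> :: "nat \<Rightarrow> nat" and l :: "nat \<Rightarrow> real" and h :: "nat \<Rightarrow> nat"
  assumes data: "iet_data r \<pi> l"
    and h_pos: "\<And>j. j \<in> {1..r} \<Longrightarrow> 0 < h j"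
begin

definition height_sum :: real where
  "height_sum = (\<Sum>q\<in>{1..r}. real (h q) * l q)"

definition cells :: "(nat \<times> nat) set" where
  "cells = (SIGMA j:{1..r}. {1..h j})"

text \<open>Left end, before normalization, of interval \<open>j\<close> on level \<open>i\<close>
  in the layout of \<open>tower_pos\<close>.\<close>

definition offset :: "nat \<times> nat \<Rightarrow> real" where
  "offset = (\<lambda>(j, i). (\<Sum>k\<in>{1..<i}. level_length r l h k) + (\<Sum>q | q \<in> {1..<j} \<and> i \<le> h q. l q))"

lemma l_pos: "j \<in> {1..r} \<Longrightarrow> 0 < l j"
  using data by (simp add: iet_data_def)

lemma height_sum_pos: "0 < height_sum"
proof -
  have "{1..r} \<noteq> {}"
    using data by (simp add: iet_data_def)
  then show ?thesis
    unfolding height_sum_def using l_pos h_pos by (intro sum_pos) auto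
qed

lemma level_length_nonneg: "0 \<le> level_length r l h i"
  unfolding level_length_def by (rule sum_nonneg) (use l_pos in force)

lemma level_part_nonneg: "j \<le> r \<Longrightarrow> 0 \<le> (\<Sum>q | q \<in> {1..<j} \<and> i \<le> h q. l q)"
  by (rule sum_nonneg) (use l_pos in \<open>auto intro: less_imp_le\<close>)

text \<open>Double counting: interval \<open>q\<close> contributes its length once for each of its
  levels among the first \<open>i\<close>, thus at most \<open>h q\<close> times.\<close>

lemma sum_level_length_le: "(\<Sum>k\<in>{1..i}. level_length r l h k) \<le> height_sum"
proof -
  have "(\<Sum>k\<in>{1..i}. level_length r l h k)
      = (\<Sum>q\<in>{1..r}. real (card {k \<in> {1..i}. k \<le> h q}) * l q)"
    unfolding level_length_def by (subst sum.swap_restrict) simp_all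
  also have "\<dots> \<le> height_sum"
    unfolding height_sum_def
  proof (rule sum_mono)
    fix q assume q: "q \<in> {1..r}"
    have "card {k \<in> {1..i}. k \<le> h q} \<le> card {1..h q}"
      by (rule card_mono) auto
    then show "real (card {k \<in> {1..i}. k \<le> h q}) * l q \<le> real (h q) * l q"
      using l_pos[OF q] by (intro mult_right_mono) auto
  qed
  finally show ?thesis .
qed

lemma offset_end_le:
  assumes "j \<in> {1..r}" "i \<le> h j" "1 \<le> i"
  shows "offset (j, i) + l j \<le> (\<Sum>k\<in>{1..i}. level_length r l h k)"
proof -
  have "(\<Sum>q | q \<in> {1..<j} \<and> i \<le> h q. l q) + l j = sum l (insert j {q. q \<in> {1..<j} \<and> i \<le> h q})"
    by simp
  also have "\<dots> \<le> level_length r l h i"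
    unfolding level_length_def by (rule sum_mono2) (use assms l_pos in \<open>auto intro: less_imp_le\<close>)
  moreover have "{1..i} = insert i {1..<i}"
    using assms(3) by auto
  ultimately show ?thesis
    by (simp add: offset_def)
qed

text \<open>The layout is lexicographic, level before interval. On different levels the length of
  the first \<open>i\<close> levels separates the cells; on one level the partial sum up to
  \<open>j'\<close> contains the one up to \<open>j\<close> together with
  \<open>l j\<close>.\<close>

lemma offset_le:
  assumes "(j, i) \<in> cells" "(j', i') \<in> cells" "i < i' \<or> i = i' \<and> j < j'"
  shows "offset (j, i) + l j \<le> offset (j', i')"
  using assms(3)
proof (elim disjE conjE)
  assume "i < i'"
  have "offset (j, i) + l j \<le> (\<Sum>k\<in>{1..i}. level_length r l h k)"
    using assms(1) by (intro offset_end_le) (auto simp: cells_def)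
  also have "\<dots> \<le> (\<Sum>k\<in>{1..<i'}. level_length r l h k)"
    by (rule sum_mono2) (use \<open>i < i'\<close> level_length_nonneg in auto)
  also have "\<dots> \<le> offset (j', i')"
    using assms(2) level_part_nonneg[of j' i'] by (simp add: offset_def cells_def)
  finally show ?thesis .
next
  assume "i = i'" "j < j'"
  have "(\<Sum>q | q \<in> {1..<j} \<and> i \<le> h q. l q) + l j = sum l (insert j {q. q \<in> {1..<j} \<and> i \<le> h q})"
    by simp
  also have "\<dots> \<le> (\<Sum>q | q \<in> {1..<j'} \<and> i \<le> h q. l q)"
    by (rule sum_mono2) (use assms \<open>j < j'\<close> l_pos in \<open>auto simp: cells_def intro: less_imp_le\<close>)
  finally show ?thesis
    by (simp add: offset_def \<open>i = i'\<close>)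
qed

text \<open>This lets \<open>pos.covers\<close> and \<open>pos.cell_unique\<close> locate each point
  of [0,1) on one level over one interval.\<close>

sublocale pos: tiling cells "\<lambda>c. offset c / height_sum" "\<lambda>c. l (fst c) / height_sum"
proof
  show "finite cells"
    by (simp add: cells_def)
  show "0 < l (fst c) / height_sum" if "c \<in> cells" for c
    using that l_pos height_sum_pos by (auto simp: cells_def)
  have "(\<Sum>c\<in>cells. l (fst c)) = height_sum"
    unfolding cells_def height_sum_def
    by (subst sum.Sigma[symmetric, where g = "\<lambda>j i. l j", unfolded split_def]) auto
  then show "(\<Sum>c\<in>cells. l (fst c) / height_sum) = 1"
    using height_sum_pos by (simp add: sum_divide_distrib[symmetric])
  show "0 \<le> offset c / height_sum" if "c \<in> cells" for c
    using that height_sum_pos level_part_nonneg[of "fst c" "snd c"]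
      sum_nonneg[of "{1..<snd c}" "level_length r l h"] level_length_nonneg
    by (auto simp: cells_def offset_def)
  show "offset c / height_sum + l (fst c) / height_sum \<le> 1" if "c \<in> cells" for c
    using offset_end_le[of "fst c" "snd c"] sum_level_length_le[of "snd c"] height_sum_pos that
    by (auto simp: cells_def add_divide_distrib[symmetric])
  show "offset c / height_sum + l (fst c) / height_sum \<le> offset c' / height_sum \<or>
        offset c' / height_sum + l (fst c') / height_sum \<le> offset c / height_sum"
    if "c \<in> cells" "c' \<in> cells" "c \<noteq> c'" for c c'
  proof -
    obtain j i j' i' where c: "c = (j, i)" "c' = (j', i')"
      by (metis surj_pair)
    have "i < i' \<or> i = i' \<and> j < j' \<or> i' < i \<or> i' = i \<and> j' < j"
      using that(3) c by auto
    then have "offset c + l (fst c) \<le> offset c' \<or> offset c' + l (fst c') \<le> offset c"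
      using offset_le[of j i j' i'] offset_le[of j' i' j i] that c by auto
    then show ?thesis
      using height_sum_pos by (simp add: add_divide_distrib[symmetric] divide_le_cancel)
  qed
qed

section \<open>Position coordinates on a tower\<close>

lemma tower_dom_cases:
  assumes "(x, i) \<in> tower_dom r l h"
  obtains j where "(j, i) \<in> cells" "x \<in> interv l j" "interv_index r l x = j"
  using assms interv_index_in[OF data, of x] by (force simp: tower_dom_def cells_def)

lemma tower_domI:
  assumes "(j, i) \<in> cells" "x \<in> interv l j"
  shows "(x, i) \<in> tower_dom r l h"
proof -
  interpret base: tiling "{1..r}" "\<lambda>j. breakpt l (j - 1)" l
    by (rule tiling_breakpt[OF data])
  have "j \<in> {1..r}"
    using assms by (auto simp: cells_def)
  then have "x \<in> {0..<1}"
    using assms(2) base.s_nonneg[of j] base.end_le_1[of j] by (auto simp: interv_def breakpt_step)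
  then show ?thesis
    using interv_index_eqI[OF data \<open>j \<in> _\<close> assms(2)] assms(1)
    by (auto simp: tower_dom_def cells_def)
qed

lemma tower_pos_cell:
  assumes "(j, i) \<in> cells" "x \<in> interv l j"
  shows "tower_pos r l h (x, i) = offset (j, i) / height_sum + (x - breakpt l (j - 1)) / height_sum"
proof -
  have "j \<in> {1..r}"
    using assms by (auto simp: cells_def)
  then have "interv_index r l x = j"
    using interv_index_eqI[OF data _ assms(2)] by simp
  then show ?thesis
    by (simp add: tower_pos_def Let_def offset_def height_sum_def add_divide_distrib)
qed

lemma tower_pos_in_cell:
  assumes "(j, i) \<in> cells" "x \<in> interv l j"
  shows "offset (j, i) / height_sum \<le> tower_pos r l h (x, i)"
    "tower_pos r l h (x, i) < offset (j, i) / height_sum + l j / height_sum"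
proof -
  have "1 \<le> j"
    using assms by (auto simp: cells_def)
  then have "0 \<le> x - breakpt l (j - 1)" "x - breakpt l (j - 1) < l j"
    using assms(2) by (auto simp: interv_def breakpt_step)
  then have "0 \<le> (x - breakpt l (j - 1)) / height_sum" "(x - breakpt l (j - 1)) / height_sum < l j / height_sum"
    using height_sum_pos by (auto intro: divide_strict_right_mono)
  then show "offset (j, i) / height_sum \<le> tower_pos r l h (x, i)"
    "tower_pos r l h (x, i) < offset (j, i) / height_sum + l j / height_sum"
    unfolding tower_pos_cell[OF assms] by simp_all
qed

lemma tower_pos_preimage:
  assumes "(j, i) \<in> cells" "offset (j, i) / height_sum \<le> y" "y < offset (j, i) / height_sum + l j / height_sum"
  obtains x where "x \<in> interv l j" "tower_pos r l h (x, i) = y"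
proof
  define x where "x = breakpt l (j - 1) + height_sum * (y - offset (j, i) / height_sum)"
  have "1 \<le> j"
    using assms by (auto simp: cells_def)
  have "height_sum * (y - offset (j, i) / height_sum) < height_sum * (l j / height_sum)"
    using assms height_sum_pos by (intro mult_strict_left_mono) auto
  moreover have "0 \<le> height_sum * (y - offset (j, i) / height_sum)"
    using assms height_sum_pos by simp
  ultimately show x: "x \<in> interv l j"
    using height_sum_pos \<open>1 \<le> j\<close> by (simp add: x_def interv_def breakpt_step)
  show "tower_pos r l h (x, i) = y"
    unfolding tower_pos_cell[OF assms(1) x] using height_sum_pos by (simp add: x_def)
qed

lemma bij_betw_tower_pos: "bij_betw (tower_pos r l h) (tower_dom r l h) {0..<1}"
  unfolding bij_betw_def
proof (intro conjI subset_antisym subsetI inj_onI)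
  fix p p' assume p: "p \<in> tower_dom r l h" "p' \<in> tower_dom r l h"
    "tower_pos r l h p = tower_pos r l h p'"
  obtain x i where x: "p = (x, i)" by (cases p)
  obtain x' i' where x': "p' = (x', i')" by (cases p')
  obtain j where j: "(j, i) \<in> cells" "x \<in> interv l j"
    using tower_dom_cases p(1) x by metis
  obtain j' where j': "(j', i') \<in> cells" "x' \<in> interv l j'"
    using tower_dom_cases p(2) x' by metis
  have eq: "(j, i) = (j', i')"
    using pos.cell_unique[OF j(1) j'(1), of "tower_pos r l h p"]
      tower_pos_in_cell[OF j] tower_pos_in_cell[OF j'] p(3) by (simp add: x x')
  then have "x = x'"
    using p(3) tower_pos_cell[OF j] tower_pos_cell[OF j'] height_sum_pos by (simp add: x x')
  then show "p = p'"
    using eq x x' by simp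
next
  fix y assume "y \<in> tower_pos r l h ` tower_dom r l h"
  then obtain x i where x: "(x, i) \<in> tower_dom r l h" "y = tower_pos r l h (x, i)"
    by auto
  obtain j where j: "(j, i) \<in> cells" "x \<in> interv l j"
    using tower_dom_cases x(1) by metis
  show "y \<in> {0..<1}"
    using pos.s_nonneg[OF j(1)] pos.end_le_1[OF j(1)] tower_pos_in_cell[OF j] by (simp add: x(2))
next
  fix y :: real assume "y \<in> {0..<1}"
  then obtain c where c: "c \<in> cells" "offset c / height_sum \<le> y" "y < offset c / height_sum + l (fst c) / height_sum"
    using pos.covers[of y] by auto
  obtain j i where "c = (j, i)"
    by (cases c)
  then obtain x where "x \<in> interv l j" "y = tower_pos r l h (x, i)" "(j, i) \<in> cells"
    using tower_pos_preimage[of j i y] c by auto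
  then show "y \<in> tower_pos r l h ` tower_dom r l h"
    using tower_domI[of j i x] by blast
qed

text \<open>Between left ends of cells the level is fixed and the base point moves affinely, with
  speed \<open>height_sum\<close>. All intermediate \<open>w\<close> are included so that wraps of
  the circle coordinate between \<open>u\<close> and \<open>v\<close> can be located later.\<close>

lemma tower_pos_pieces:
  obtains P where "finite P"
    "\<And>y y'. \<lbrakk>0 \<le> y; y \<le> y'; y' < 1; {y<..y'} \<inter> P = {}\<rbrakk> \<Longrightarrow>
      \<exists>i u v. u \<le> v \<and> y' - y = (v - u) / height_sum \<and>
        (\<forall>w\<in>{u..v}. (w, i) \<in> tower_dom r l h \<and> tower_pos r l h (w, i) = y + (w - u) / height_sum)"
proof
  show "finite ((\<lambda>c. offset c / height_sum) ` cells)"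
    using pos.finite_C by simp
  fix y y' :: real
  assume *: "0 \<le> y" "y \<le> y'" "y' < 1" "{y<..y'} \<inter> (\<lambda>c. offset c / height_sum) ` cells = {}"
  obtain c where c: "c \<in> cells" "offset c / height_sum \<le> y'" "y' < offset c / height_sum + l (fst c) / height_sum"
    using pos.covers[of y'] * by auto
  then have start: "offset c / height_sum \<le> y"
    using *(4) by (meson disjoint_iff greaterThanAtMost_iff imageI not_le)
  obtain j i where ji: "c = (j, i)"
    by (cases c)
  obtain v where v: "v \<in> interv l j" "tower_pos r l h (v, i) = y'"
    using tower_pos_preimage[of j i y'] c ji by auto
  obtain u where u: "u \<in> interv l j" "tower_pos r l h (u, i) = y"
    using tower_pos_preimage[of j i y] c ji * start by auto
  have w: "(w, i) \<in> tower_dom r l h \<and> tower_pos r l h (w, i) = y + (w - u) / height_sum"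
    if "w \<in> interv l j" for w
    using tower_domI[of j i w] tower_pos_cell[of j i w] tower_pos_cell[of j i u] that u c(1) ji
    by (simp add: diff_divide_distrib)
  have "y' - y = (v - u) / height_sum"
    using w[OF v(1)] v(2) by simp
  moreover have "u \<le> v"
  proof -
    have "0 \<le> (v - u) / height_sum"
      using calculation *(2) by simp
    then show ?thesis
      using height_sum_pos by (simp add: zero_le_divide_iff)
  qed
  moreover have "{u..v} \<subseteq> interv l j"
    using u(1) v(1) by (auto simp: interv_def)
  ultimately show "\<exists>i u v. u \<le> v \<and> y' - y = (v - u) / height_sum \<and>
      (\<forall>w\<in>{u..v}. (w, i) \<in> tower_dom r l h \<and> tower_pos r l h (w, i) = y + (w - u) / height_sum)"
    using w by blast
qed

lemma tower_tower_pos: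
  assumes "p \<in> tower_dom r l h"
  shows "tower r \<pi> l h (tower_pos r l h p) = tower_pos r l h (tower_map r \<pi> l h p)"
  using bij_betwE[OF bij_betw_tower_pos] bij_betw_inv_into_left[OF bij_betw_tower_pos] assms
  by (simp add: tower_def)

lemma tower_map_in:
  assumes "p \<in> tower_dom r l h"
  shows "tower_map r \<pi> l h p \<in> tower_dom r l h"
proof -
  obtain x i where p: "p = (x, i)"
    by (cases p)
  have "iet r \<pi> l x \<in> {0..<1}"
    using bij_betwE[OF bij_betw_iet[OF data]] assms by (auto simp: p tower_dom_def)
  then show ?thesis
    using assms h_pos interv_index_in(1)[OF data, of "iet r \<pi> l x"]
    by (auto simp: tower_map_def p tower_dom_def Suc_le_eq)
qed

end

subsection \<open>Rotations and towers of constant height\<close>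

lemma iet_data_2:
  assumes "iet_data 2 swap12 l"
  shows "0 < l 1" "0 < l 2" "l 1 + l 2 = 1"
proof -
  have "{1..2} = {1, 2::nat}"
    by auto
  then show "0 < l 1" "0 < l 2" "l 1 + l 2 = 1"
    using assms by (simp_all add: iet_data_def)
qed

lemma iet_data_2I:
  assumes "0 < \<theta>" "\<theta> < 1"
  shows "iet_data 2 swap12 (\<lambda>i. if i = 1 then 1 - \<theta> else \<theta>)"
proof -
  have "{1..2} = {1, 2::nat}"
    by auto
  moreover have "swap12 permutes {1..2}"
    by (rule permutes_swap_id) auto
  ultimately show ?thesis
    using assms by (simp add: iet_data_def)
qed

lemma interv_2: "interv l 1 = {0..<l 1}" "l 1 + l 2 = 1 \<Longrightarrow> interv l 2 = {l 1..<1}"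
  by (simp_all add: interv_def breakpt_def numeral_2_eq_2)

lemma interv_index_2:
  assumes "iet_data 2 swap12 l" "x \<in> {0..<1}"
  shows "interv_index 2 l x = (if x < l 1 then 1 else 2)"
proof (cases "x < l 1")
  case True
  then show ?thesis
    using interv_index_eqI[OF assms(1), of 1 x] assms(2) by (simp add: interv_2[simplified])
next
  case False
  then show ?thesis
    using interv_index_eqI[OF assms(1), of 2 x] interv_2(2)[of l] iet_data_2[OF assms(1)] assms(2)
    by simp
qed

lemma rotation_apply:
  assumes "iet_data 2 swap12 l" "x \<in> {0..<1}"
  shows "iet 2 swap12 l x = (if x < l 1 then x + l 2 else x - l 1)"
proof -
  have b: "breakpt l (1 - 1) = 0" "breakpt l (2 - 1) = l 1"
    by (simp_all add: breakpt_def)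
  have "{i \<in> {1..2}. swap12 i < swap12 1} = {2}" "{i \<in> {1..2}. swap12 i < swap12 2} = {}"
    by (auto simp: Transposition.transpose_def)
  then have s: "sum l {i \<in> {1..2}. swap12 i < swap12 1} = l 2" "sum l {i \<in> {1..2}. swap12 i < swap12 2} = 0"
    by (simp_all only:) simp_all
  note l = iet_data_2[OF assms(1)]
  show ?thesis
  proof (cases "x < l 1")
    case True
    then have "x \<in> interv l 1"
      unfolding interv_2(1) using assms(2) by simp
    then have "iet 2 swap12 l x = l 2 + (x - 0)"
      using iet_shift[OF assms(1), of 1 x] s(1) b(1) by (metis atLeastAtMost_iff one_le_numeral order_refl)
    then show ?thesis
      using True by simp
  next
    case False
    then have "x \<in> interv l 2"
      unfolding interv_2(2)[OF l(3)] using assms(2) by simp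
    then have "iet 2 swap12 l x = 0 + (x - l 1)"
      using iet_shift[OF assms(1), of 2 x] s(2) b(2) by (metis atLeastAtMost_iff one_le_numeral order_refl)
    then show ?thesis
      using False by simp
  qed
qed

lemma rotation_frac:
  assumes "iet_data 2 swap12 l" "x \<in> {0..<1}"
  shows "iet 2 swap12 l x = frac (x + l 2)"
proof -
  note l = iet_data_2[OF assms(1)]
  have "frac (x + l 2) = (if x < l 1 then x + l 2 else x - l 1)"
    unfolding frac_unique_iff
  proof (intro conjI)
    have "x + l 2 - (if x < l 1 then x + l 2 else x - l 1) = (if x < l 1 then 0 else 1)"
      using l(3) by auto
    then show "x + l 2 - (if x < l 1 then x + l 2 else x - l 1) \<in> \<int>"
      by (simp split: if_splits)
  qed (use l assms(2) in auto)
  then show ?thesis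
    using rotation_apply[OF assms] by simp
qed

lemma cyl_shift_1: "y \<in> {0..<1} \<Longrightarrow> cyl_shift 1 \<theta> t j y = frac (y + t + \<theta> * of_int j)"
proof -
  assume "y \<in> {0..<1}"
  then have "\<lfloor>y\<rfloor> = 0" "frac y = y"
    by (simp_all add: floor_eq_iff)
  then show ?thesis
    using \<open>y \<in> _\<close> by (simp add: cyl_shift_def Let_def)
qed

text \<open>A rotation is a tower of height 1, so its powers and its inverse come from the group law
  of \<open>cyl_shift\<close>.\<close>

lemma rotation_eq_cyl_shift:
  assumes "iet_data 2 swap12 l"
  shows "iet 2 swap12 l = cyl_shift 1 (l 2) 0 1"
proof
  fix x
  show "iet 2 swap12 l x = cyl_shift 1 (l 2) 0 1 x"
  proof (cases "x \<in> {0..<1}")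
    case True
    then show ?thesis
      using rotation_frac[OF assms True] cyl_shift_1[OF True] by simp
  next
    case False
    then show ?thesis
      unfolding iet_def cyl_shift_def by (simp only: if_False)
  qed
qed

lemma rotation_funpow:
  assumes "iet_data 2 swap12 l" "x \<in> {0..<1}"
  shows "(iet 2 swap12 l ^^ k) x = frac (x + real k * l 2)"
  unfolding rotation_eq_cyl_shift[OF assms(1)] cyl_shift_funpow[OF zero_less_one]
  using cyl_shift_1[OF assms(2)] by (simp add: mult.commute)

lemma inv_rotation_funpow:
  assumes "iet_data 2 swap12 l" "x \<in> {0..<1}"
  shows "(inv (iet 2 swap12 l) ^^ k) x = frac (x - real k * l 2)"
  unfolding rotation_eq_cyl_shift[OF assms(1)] inv_cyl_shift[OF zero_less_one]
    cyl_shift_funpow[OF zero_less_one]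
  using cyl_shift_1[OF assms(2)] by (simp add: mult.commute)

section \<open>Irrational rotations and minimality\<close>

text \<open>Multiples of \<theta> are dense modulo 1; the target is the midpoint of the interval,
  with half its length as tolerance. The point hit lies in [0,1), so it is its own fractional
  part.\<close>

lemma irrational_orbit_meets_interval:
  fixes \<theta> :: real
  assumes "\<theta> \<notin> \<rat>" "0 \<le> a" "a < b" "b \<le> 1"
  shows "\<exists>k::nat. a < frac (x + real k * \<theta>) \<and> frac (x + real k * \<theta>) < b"
proof -
  have "0 < (b - a) / 2"
    using assms(3) by simp
  then obtain h k where k: "k > 0" "\<bar>of_int k * \<theta> - of_int h - ((a + b) / 2 - x)\<bar> < (b - a) / 2"
    using sequence_of_fractional_parts_is_dense[OF assms(1)] by metis
  define z where "z = x + real (nat k) * \<theta> - of_int h"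
  have "\<bar>z - (a + b) / 2\<bar> < (b - a) / 2"
    using k by (simp add: z_def algebra_simps)
  then have "a < z" "z < b"
    by (simp_all add: abs_less_iff field_simps)
  moreover have "frac (x + real (nat k) * \<theta>) = z"
    unfolding frac_unique_iff using \<open>a < z\<close> \<open>z < b\<close> assms by (simp add: z_def)
  ultimately show ?thesis
    by metis
qed

text \<open>With angle \<open>p / q\<close> the orbit of 0 stays among finitely many multiples of
  \<open>1 / q\<close>; with an irrational angle the forward orbits already meet every
  interval.\<close>

lemma minimal_rotation_iff_irrational:
  assumes "iet_data 2 swap12 l"
  shows "minimal (iet 2 swap12 l) \<longleftrightarrow> l 2 \<notin> \<rat>"
proof
  assume min: "minimal (iet 2 swap12 l)"
  show "l 2 \<notin> \<rat>"
  proof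
    assume "l 2 \<in> \<rat>"
    then obtain p q :: int where q: "0 < q" "l 2 = of_int p / of_int q"
      by (meson Rats_cases')
    define F where "F = (\<lambda>i. of_int i / of_int q :: real) ` {0..q}"
    have F: "frac (of_int i * l 2) \<in> F" for i
    proof -
      have "frac (of_int i * l 2) = of_int (i * p - \<lfloor>of_int i * l 2\<rfloor> * q) / of_int q"
        using q by (simp add: frac_def field_simps)
      moreover define n where "n = i * p - \<lfloor>of_int i * l 2\<rfloor> * q"
      ultimately have e: "frac (of_int i * l 2) = of_int n / of_int q"
        by simp
      have "0 \<le> of_int n / real_of_int q" "of_int n / real_of_int q < 1"
        unfolding e[symmetric] by (simp_all add: frac_lt_1)
      then have "0 \<le> n" "n < q"
        using q(1) by (simp_all add: zero_le_divide_iff)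
      then show ?thesis
        unfolding F_def e by auto
    qed
    have "(iet 2 swap12 l ^^ k) 0 \<in> F" "(inv (iet 2 swap12 l) ^^ k) 0 \<in> F" for k
      using F[of "int k"] F[of "- int k"] rotation_funpow[OF assms, of 0 k]
        inv_rotation_funpow[OF assms, of 0 k] by simp_all
    then have "full_orbit (iet 2 swap12 l) 0 \<subseteq> F"
      unfolding full_orbit_def by blast
    moreover have "closed F" "finite F"
      by (auto simp: F_def intro!: finite_imp_closed)
    ultimately have "closure (full_orbit (iet 2 swap12 l) 0) \<subseteq> F"
      by (intro closure_minimal)
    moreover have "{0..<1} \<subseteq> closure (full_orbit (iet 2 swap12 l) 0)"
      using min unfolding minimal_def by simp
    ultimately have "finite {0..<1::real}"
      using \<open>finite F\<close> by (meson finite_subset)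
    then show False
      by (simp add: infinite_Ico)
  qed
next
  assume irr: "l 2 \<notin> \<rat>"
  show "minimal (iet 2 swap12 l)"
    unfolding minimal_def
  proof (intro ballI subsetI)
    fix x y :: real assume x: "x \<in> {0..<1}" and y: "y \<in> {0..<1}"
    show "y \<in> closure (full_orbit (iet 2 swap12 l) x)"
      unfolding closure_approachable
    proof (intro allI impI)
      fix e :: real assume "0 < e"
      then obtain k where k: "y < frac (x + real k * l 2)" "frac (x + real k * l 2) < min 1 (y + e)"
        using irrational_orbit_meets_interval[OF irr, of y "min 1 (y + e)" x] y by auto
      have "(iet 2 swap12 l ^^ k) x \<in> full_orbit (iet 2 swap12 l) x"
        by (simp add: full_orbit_def)
      moreover have "dist ((iet 2 swap12 l ^^ k) x) y < e"
        unfolding rotation_funpow[OF assms x] dist_real_def using k by simp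
      ultimately show "\<exists>z\<in>full_orbit (iet 2 swap12 l) x. dist z y < e"
        by blast
    qed
  qed
qed

text \<open>All levels have length 1, so the point \<open>x\<close> on level \<open>i\<close> sits
  at \<open>(i - 1 + x) / d\<close>. Leaving the top level is the carry in \<open>cyl_shift\<close>,
  which applies the rotation once.\<close>

lemma tower_constant_height:
  assumes data: "iet_data 2 swap12 l" and d: "0 < d"
  shows "tower 2 swap12 l (\<lambda>_. d) = cyl_shift d (l 2) 0 1"
proof
  interpret tower_data 2 swap12 l "\<lambda>_. d"
    using assms by unfold_locales
  have "{1..2} = {1, 2::nat}"
    by auto
  then have hs: "height_sum = real d"
    using iet_data_2(3)[OF data] by (simp add: height_sum_def distrib_left[symmetric])
  have ll: "level_length 2 l (\<lambda>_. d) k = 1" if "k \<le> d" for k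
  proof -
    have "{j. j \<in> {1..2} \<and> k \<le> d} = {1, 2::nat}"
      using that by auto
    then show ?thesis
      using iet_data_2(3)[OF data] by (simp add: level_length_def)
  qed
  have pos: "tower_pos 2 l (\<lambda>_. d) (x, i) = (of_int (int i - 1) + x) / real d"
    if xi: "x \<in> {0..<1}" "1 \<le> i" "i \<le> d" for x i
  proof -
    obtain j where j: "(j, i) \<in> cells" "x \<in> interv l j"
    proof (rule tower_dom_cases)
      show "(x, i) \<in> tower_dom 2 l (\<lambda>_. d)"
        using xi by (simp add: tower_dom_def)
    qed
    have "(\<Sum>k\<in>{1..<i}. level_length 2 l (\<lambda>_. d) k) = real (i - 1)"
      using ll xi(3) by simp
    moreover have "{q. q \<in> {1..<j} \<and> i \<le> d} = {1..j - 1}"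
      using xi(3) j(1) by (auto simp: cells_def)
    ultimately show ?thesis
      using tower_pos_cell[OF j] xi(2)
      by (simp add: hs offset_def breakpt_def add_divide_distrib diff_divide_distrib of_nat_diff)
  qed
  fix y
  show "tower 2 swap12 l (\<lambda>_. d) y = cyl_shift d (l 2) 0 1 y"
  proof (cases "y \<in> {0..<1}")
    case False
    then show ?thesis
      unfolding tower_def cyl_shift_def by (simp only: if_False)
  next
    case True
    then obtain n x where y: "0 \<le> n" "n < int d" "0 \<le> x" "x < 1" "y = (of_int n + x) / real d"
      by (rule cyl_coords[OF d])
    define i where "i = nat n + 1"
    have i: "int i = n + 1" "1 \<le> i" "i \<le> d"
      using y by (simp_all add: i_def)
    have x: "x \<in> {0..<1}"
      using y by simp
    have p: "(x, i) \<in> tower_dom 2 l (\<lambda>_. d)" "y = tower_pos 2 l (\<lambda>_. d) (x, i)"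
      using pos[OF x i(2,3)] x i y(5) by (simp_all add: tower_dom_def)
    have "tower 2 swap12 l (\<lambda>_. d) y = tower_pos 2 l (\<lambda>_. d) (tower_map 2 swap12 l (\<lambda>_. d) (x, i))"
      unfolding p(2) by (rule tower_tower_pos[OF p(1)])
    also have "\<dots> = (of_int ((n + 1) mod int d) + frac (x + 0 + l 2 * of_int ((n + 1) div int d))) / real d"
    proof (cases "i + 1 \<le> d")
      case True
      then have "(n + 1) mod int d = n + 1" "(n + 1) div int d = 0"
        using i y(1) by (simp_all add: div_pos_pos_trivial)
      then show ?thesis
        using True pos[OF x, of "i + 1"] i x by (simp add: tower_map_def frac_eq)
    next
      case False
      then have "n + 1 = int d"
        using i by simp
      then have "(n + 1) mod int d = 0" "(n + 1) div int d = 1"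
        using d by simp_all
      moreover have "tower_map 2 swap12 l (\<lambda>_. d) (x, i) = (frac (x + l 2), 1)"
        unfolding tower_map_def rotation_frac[OF data x, symmetric] using False by simp
      ultimately show ?thesis
        using pos[of "frac (x + l 2)" 1] d by (simp add: frac_lt_1)
    qed
    also have "\<dots> = cyl_shift d (l 2) 0 1 y"
      unfolding y(5) cyl_shift_point[OF d y(1-4)] by simp
    finally show ?thesis .
  qed
qed

text \<open>The \<open>d\<close>-th power of the cylinder map preserves the bottom level, whereas
  the \<open>d\<close>-th power of the rotation is again irrational and has dense orbits. Carried
  back by \<open>g\<close>, density would bring the orbit of 0 into a short interval starting at
  \<open>1 / d\<close>.\<close>

lemma not_conjugate_rotation:
  assumes d: "2 \<le> d" and data: "iet_data 2 swap12 l" and irr: "l 2 \<notin> \<rat>"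
  shows "\<not> conjugate (cyl_shift d \<theta> 0 1) (iet 2 swap12 l)"
proof
  let ?V = "cyl_shift d \<theta> 0 1" and ?R = "iet 2 swap12 l"
  assume "conjugate ?V ?R"
  then obtain g where g: "g \<in> IETs" "?R = g \<circ> ?V \<circ> inv g"
    unfolding conjugate_def by blast
  note bij = IETs_bij[OF g(1)]
  have d0: "0 < d"
    using d by simp
  have orbit: "(?V ^^ (d * j)) 0 \<in> {0..<1 / real d}" for j
  proof -
    have "?V ^^ (d * j) = (?V ^^ d) ^^ j"
      by (simp add: funpow_mult mult.commute)
    also have "?V ^^ d = cyl_shift d \<theta> \<theta> 0"
      using cyl_shift_wrap[OF d0, of \<theta> 0 0] by (simp add: cyl_shift_funpow[OF d0])
    finally have "(?V ^^ (d * j)) 0 = frac (real j * \<theta>) / real d"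
      using cyl_shift_point[OF d0, of 0 0 \<theta> "real j * \<theta>" 0] d0
      by (simp add: cyl_shift_funpow[OF d0])
    then show ?thesis
      using d0 by (simp add: frac_lt_1 divide_strict_right_mono)
  qed
  obtain P where P: "finite P"
    "\<And>x y. \<lbrakk>0 \<le> x; x \<le> y; y < 1; {x<..y} \<inter> P = {}\<rbrakk> \<Longrightarrow> g y - g x = y - x"
    using IETs_piecewise_translation[OF g(1)] unfolding piecewise_translation_def by metis
  obtain \<delta> where \<delta>: "\<delta> > 0" "\<And>p. \<lbrakk>p \<in> P; p \<noteq> 1 / real d\<rbrakk> \<Longrightarrow> \<delta> \<le> dist (1 / real d) p"
    using finite_set_avoid[OF P(1)] by metis
  have d2: "1 / real d \<le> 1 / 2"
    using d by (simp add: field_simps)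
  \<comment> \<open>On \<open>[1 / d, 1 / d + e)\<close> the map \<open>g\<close> is a translation:
    a cut at \<open>1 / d\<close> itself does no harm, as pieces are closed on the left. The bound
    1/2 keeps the interval inside [0,1), as \<open>1 / d \<le> 1 / 2\<close>.\<close>
  define e where "e = min \<delta> (1 / 2)"
  have tr: "g (1 / real d + t) = g (1 / real d) + t" if "0 \<le> t" "t < e" for t
  proof -
    have "{1 / real d<..1 / real d + t} \<inter> P = {}"
    proof (rule ccontr)
      assume "\<not> ?thesis"
      then obtain p where "p \<in> P" "1 / real d < p" "p \<le> 1 / real d + t"
        by auto
      then show False
        using \<delta>(2)[of p] that by (simp add: dist_real_def e_def)
    qed
    then show ?thesis
      using P(2)[of "1 / real d" "1 / real d + t"] that d2 by (simp add: e_def)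
  qed
  have in01: "1 / real d + t \<in> {0..<1}" if "0 \<le> t" "t < e" for t
    using that d2 by (simp add: e_def)
  have ge0: "0 \<le> g (1 / real d)" and lt1: "g (1 / real d) < 1"
    using IETs_in[OF g(1), of "1 / real d"] in01[of 0] \<delta>(1) by (auto simp: e_def)
  define b where "b = min 1 (g (1 / real d) + e)"
  have "real d * l 2 \<notin> \<rat>"
  proof
    assume "real d * l 2 \<in> \<rat>"
    then have "real d * l 2 / real d \<in> \<rat>"
      by (rule Rats_divide) simp
    then show False
      using irr d0 by simp
  qed
  then obtain j where j: "g (1 / real d) < frac (g 0 + real j * (real d * l 2))"
    "frac (g 0 + real j * (real d * l 2)) < b"
    using irrational_orbit_meets_interval[of "real d * l 2" "g (1 / real d)" b "g 0"] ge0 lt1 \<delta>(1)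
    by (auto simp: b_def e_def)
  \<comment> \<open>Chosen so that the orbit point of the rotation is
    \<open>g (1 / d + t)\<close>.\<close>
  define t where "t = frac (g 0 + real j * (real d * l 2)) - g (1 / real d)"
  have t: "0 \<le> t" "t < e"
    using j by (simp_all add: t_def b_def)
  have "g 0 \<in> {0..<1}"
    using IETs_in[OF g(1), of 0] by simp
  then have "(?R ^^ (d * j)) (g 0) = g (1 / real d + t)"
    unfolding rotation_funpow[OF data \<open>g 0 \<in> _\<close>] tr[OF t] by (simp add: t_def mult.assoc mult.left_commute)
  moreover have "(?R ^^ (d * j)) (g 0) = g ((?V ^^ (d * j)) 0)"
    unfolding g(2) conj_funpow[OF bij] using bij by (simp add: bij_is_inj)
  ultimately have "(?V ^^ (d * j)) 0 = 1 / real d + t"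
    using bij by (simp add: bij_is_inj inj_eq)
  then show False
    using orbit[of j] t by simp
qed

subsection \<open>Towers of two heights over a rotation\<close>

text \<open>Source of injectivity of the conjugating map, where \<open>m * B - n * A\<close> is a
  difference of rotation counts. Equal signs of \<open>A\<close> and \<open>B\<close> would give
  \<open>|x - y| \<ge> 1\<close>; opposite signs give a count that is negative or at least
  \<open>m + n\<close>. If just one of them is nonzero, the count is negative or \<open>y\<close>
  lies on the side of \<open>u\<close> whose bound it reaches.\<close>

lemma no_early_coincidence:
  fixes m n A B :: int and u v x y :: real
  assumes "0 < u" "0 < v" "u + v = 1" "0 < m" "0 < n" "x \<in> {0..<1}" "y \<in> {0..<1}"
    and xy: "x - y = of_int A * u + of_int B * v"
    and ge: "0 \<le> m * B - n * A" and lt: "m * B - n * A < (if y < u then m else n)"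
  shows "A = 0 \<and> B = 0"
proof -
  have nA: "n \<le> n * \<bar>A\<bar>" if "A \<noteq> 0"
    using that assms by simp
  have mB: "m \<le> m * \<bar>B\<bar>" if "B \<noteq> 0"
    using that assms by simp
  have uA: "u \<le> \<bar>of_int A\<bar> * u" if "A \<noteq> 0"
  proof -
    have "1 \<le> \<bar>real_of_int A\<bar>"
      using that by linarith
    then show ?thesis
      using assms by simp
  qed
  have vB: "v \<le> \<bar>of_int B\<bar> * v" if "B \<noteq> 0"
  proof -
    have "1 \<le> \<bar>real_of_int B\<bar>"
      using that by linarith
    then show ?thesis
      using assms by simp
  qed
  consider "A = 0 \<and> B = 0" | "0 < A" "0 < B" | "A < 0" "B < 0" | "A = 0" "B < 0" | "0 < A" "B \<le> 0"
    | "A < 0" "0 < B" | "A = 0" "0 < B" | "A < 0" "B = 0"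
    by linarith
  then show ?thesis
  proof cases
    case 2
    then show ?thesis
      using uA vB xy assms(3,6,7) by (simp split: if_splits)
  next
    case 3
    then show ?thesis
      using uA vB xy assms(3,6,7) by (simp split: if_splits)
  next
    case 4
    then show ?thesis
      using mB ge assms(4) by simp
  next
    case 5
    then show ?thesis
      using ge mult_pos_pos[OF assms(5) 5(1)] mult_nonneg_nonpos[OF less_imp_le[OF assms(4)] 5(2)] by simp
  next
    case 6
    then have "n \<le> - (n * A)" "m \<le> m * B"
      using nA mB by simp_all
    then show ?thesis
      using lt assms(4,5) by (smt (verit))
  next
    case 7
    then have "v \<le> of_int B * v" "x - y = of_int B * v"
      using vB xy by simp_all
    then have "y < u"
      using assms(3,6) by simp
    then show ?thesis
      using mB lt 7 by simp
  next
    case 8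
    then have "u \<le> - (of_int A * u)" "x - y = of_int A * u"
      using uA xy by simp_all
    then have "\<not> y < u"
      using assms(6) by simp
    then show ?thesis
      using nA lt 8 by simp
  qed
qed

text \<open>
  With \<open>m' b - n' a = 1\<close>, \<open>c = a l\<^sub>1 + b l\<^sub>2\<close> and \<open>L = m' l\<^sub>1 + n' l\<^sub>2\<close> one has
  \<open>m' c = l\<^sub>2 + a L\<close> and \<open>n' c = - l\<^sub>1 + b L\<close>. The second argument of \<open>\<phi>\<close> numbers the levels
  from \<open>0\<close>, so that its division by \<open>d\<close> gives the target level and the number of rotations by \<open>c\<close>.
\<close>

lemma conjugate_tower_cyl_shift:
  fixes d m' n' :: nat
  assumes data: "iet_data 2 swap12 l" and irr: "l 2 \<notin> \<rat>"
    and pos: "0 < d" "0 < m'" "0 < n'" and cop: "coprime m' n'"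
  obtains \<theta> where "0 < \<theta>" "\<theta> < 1" "\<theta> \<notin> \<rat>"
    "conjugate (tower 2 swap12 l (\<lambda>j. if j = 1 then d * m' else d * n')) (cyl_shift d \<theta> 0 1)"
proof -
  define h where "h = (\<lambda>j::nat. if j = 1 then d * m' else d * n')"
  interpret tower_data 2 swap12 l h
    by unfold_locales (use data pos in \<open>auto simp: h_def\<close>)
  note l = iet_data_2[OF data]
  obtain a b :: int where ab: "int m' * b - int n' * a = 1"
  proof -
    obtain p q where "p * int m' + q * int n' = gcd (int m') (int n')"
      using bezout_int by blast
    then have "int m' * p - int n' * (- q) = 1"
      using cop by (simp add: mult.commute)
    then show ?thesis
      by (rule that)
  qed
  have ab_r: "real m' * of_int b - real n' * of_int a = 1"
    using arg_cong[OF ab, of real_of_int] by simp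
  define c where "c = of_int a * l 1 + of_int b * l 2"
  define L where "L = real m' * l 1 + real n' * l 2"
  have L: "0 < L"
    using l pos by (simp add: L_def add_pos_pos)
  have "{1..2} = {1, 2::nat}"
    by auto
  then have "height_sum = real (h 1) * l 1 + real (h 2) * l 2"
    unfolding height_sum_def by simp
  then have hs: "height_sum = real d * L"
    by (simp add: h_def L_def algebra_simps)
  \<comment> \<open>Rotation by \<open>c\<close> on the circle of length \<open>L\<close>, rescaled
    to circumference 1.\<close>
  define \<theta> where "\<theta> = frac (c / L)"
  have irr\<theta>: "\<theta> \<notin> \<rat>"
  proof
    assume "\<theta> \<in> \<rat>"
    then have "\<theta> + of_int \<lfloor>c / L\<rfloor> \<in> \<rat>"
      by simp
    then have "c / L \<in> \<rat>"
      by (simp add: \<theta>_def frac_def)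
    then obtain \<rho> where \<rho>: "\<rho> \<in> \<rat>" "c = \<rho> * L"
      using L by (metis nonzero_eq_divide_eq less_irrefl)
    \<comment> \<open>Substituting \<open>l 1 = 1 - l 2\<close> into \<open>c = \<rho> * L\<close>
      gives \<open>B * l 2 = A\<close> with rational \<open>A\<close> and \<open>B\<close>.
      Irrationality of \<open>l 2\<close> forces both to vanish, so \<open>(a, b)\<close> is
      proportional to \<open>(m', n')\<close>, against the Bezout identity.\<close>
    define B where "B = of_int b - of_int a - \<rho> * (real n' - real m')"
    define A where "A = \<rho> * real m' - of_int a"
    have "l 1 = 1 - l 2"
      using l(3) by simp
    then have AB: "B * l 2 = A"
      using \<rho>(2) unfolding A_def B_def c_def L_def \<open>l 1 = 1 - l 2\<close>
      by (simp add: algebra_simps)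
    have "A \<in> \<rat>" "B \<in> \<rat>"
      using \<rho>(1) by (simp_all add: A_def B_def)
    have "B = 0"
    proof (rule ccontr)
      assume "B \<noteq> 0"
      then have "l 2 = A / B"
        using AB by (simp add: field_simps)
      then show False
        using irr \<open>A \<in> \<rat>\<close> \<open>B \<in> \<rat>\<close> by simp
    qed
    then have "of_int a = \<rho> * real m'" "of_int b = \<rho> * real n'"
      using AB by (simp_all add: A_def B_def algebra_simps)
    then show False
      using ab_r by simp
  qed
  have \<theta>01: "0 < \<theta>" "\<theta> < 1"
  proof -
    have "\<theta> \<noteq> 0"
      using irr\<theta> by auto
    then show "0 < \<theta>"
      unfolding \<theta>_def by (metis frac_ge_0 less_le)
  qed (simp add: \<theta>_def frac_lt_1)

  define \<phi> where "\<phi> x N = (of_int (N mod int d) + frac ((x + of_int (N div int d) * c) / L)) / real d"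
    for x :: real and N :: int
  have \<phi>_in: "\<phi> x N \<in> {0..<1}" for x N
    unfolding \<phi>_def by (rule cyl_point_in[OF pos(1)]) (use pos in \<open>simp_all add: frac_lt_1\<close>)
  \<comment> \<open>The integer and fractional parts of \<open>d * \<phi> x N\<close> are read off
    separately; equal fractional parts mean congruence modulo \<open>L\<close>.\<close>
  have \<phi>_eqD: "N mod int d = N' mod int d \<and>
      (\<exists>e::int. x - x' = of_int (N' div int d - N div int d) * c + of_int e * L)"
    if "\<phi> x N = \<phi> x' N'" for x x' N N'
  proof -
    let ?f = "frac ((x + of_int (N div int d) * c) / L)"
      and ?f' = "frac ((x' + of_int (N' div int d) * c) / L)"
    have eq: "of_int (N mod int d) + ?f = of_int (N' mod int d) + ?f'"
      using that pos(1) by (simp add: \<phi>_def)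
    have "\<lfloor>of_int (N mod int d) + ?f\<rfloor> = N mod int d" "\<lfloor>of_int (N' mod int d) + ?f'\<rfloor> = N' mod int d"
      by (simp_all add: floor_unique frac_lt_1)
    then have mod: "N mod int d = N' mod int d"
      using eq by simp
    then have "?f = ?f'"
      using eq by simp
    then obtain e :: int where "(x + of_int (N div int d) * c) / L = (x' + of_int (N' div int d) * c) / L + of_int e"
      by (rule frac_eqE)
    then have "x + of_int (N div int d) * c = x' + of_int (N' div int d) * c + of_int e * L"
      using L by (simp add: field_simps)
    then show ?thesis
      using mod by (intro conjI exI[of _ e]) (auto simp: algebra_simps)
  qed
  have dom: "x \<in> {0..<1}" "1 \<le> i" "(int i - 1) div int d < (if x < l 1 then int m' else int n')"
    "0 \<le> (int i - 1) div int d"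
    if "(x, i) \<in> tower_dom 2 l h" for x i
  proof -
    show x: "x \<in> {0..<1}" and i: "1 \<le> i"
      using that by (auto simp: tower_dom_def)
    have "int i - 1 < int d * (if x < l 1 then int m' else int n')"
      using that interv_index_2[OF data x] by (auto simp: tower_dom_def h_def simp flip: of_nat_mult)
    moreover have "int d * ((int i - 1) div int d) \<le> int i - 1"
      using mult_div_mod_eq[of "int d" "int i - 1"] pos_mod_sign[of "int d" "int i - 1"] pos(1) by linarith
    ultimately have "int d * ((int i - 1) div int d) < int d * (if x < l 1 then int m' else int n')"
      by linarith
    then show "(int i - 1) div int d < (if x < l 1 then int m' else int n')"
      by (rule mult_left_less_imp_less) simp
    show "0 \<le> (int i - 1) div int d"
      using i pos(1) by (simp add: pos_imp_zdiv_nonneg_iff)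
  qed
  \<comment> \<open>Ordering the two rotation counts makes their difference \<open>k\<close>
    nonnegative; the general case follows by symmetry.\<close>
  have inj_le: "x = x' \<and> i = i'"
    if p: "(x, i) \<in> tower_dom 2 l h" "(x', i') \<in> tower_dom 2 l h" "\<phi> x (int i - 1) = \<phi> x' (int i' - 1)"
      and le: "(int i - 1) div int d \<le> (int i' - 1) div int d" for x x' i i'
  proof -
    define k where "k = (int i' - 1) div int d - (int i - 1) div int d"
    obtain e :: int where mod: "(int i - 1) mod int d = (int i' - 1) mod int d"
      and e: "x - x' = of_int k * c + of_int e * L"
      using \<phi>_eqD[OF p(3)] unfolding k_def by blast
    \<comment> \<open>\<open>A\<close> and \<open>B\<close> are the coefficients of
      \<open>l 1\<close> and \<open>l 2\<close> in \<open>k * c + e * L\<close>, and the Bezout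
      identity recovers \<open>k\<close> as \<open>m' * B - n' * A\<close>.\<close>
    define A where "A = k * a + e * int m'"
    define B where "B = k * b + e * int n'"
    have "int m' * B - int n' * A = k * (int m' * b - int n' * a)"
      by (simp add: A_def B_def algebra_simps)
    then have k: "int m' * B - int n' * A = k"
      using ab by simp
    have "A = 0 \<and> B = 0"
    proof (rule no_early_coincidence[where u = "l 1" and v = "l 2" and x = x and y = x'])
      show "x - x' = of_int A * l 1 + of_int B * l 2"
        unfolding e by (simp add: A_def B_def c_def L_def algebra_simps)
      show "0 \<le> int m' * B - int n' * A"
        unfolding k using le by (simp add: k_def)
      show "int m' * B - int n' * A < (if x' < l 1 then int m' else int n')"
        unfolding k using dom(3)[OF p(2)] dom(4)[OF p(1)] by (simp add: k_def)
    qed (use l pos dom(1)[OF p(1)] dom(1)[OF p(2)] in simp_all)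
    then have "k = 0"
      using k by simp
    \<comment> \<open>With \<open>k = 0\<close>, the equation \<open>A = 0\<close> reads
      \<open>e * m' = 0\<close>, so \<open>e = 0\<close>.\<close>
    have "x - x' = 0"
      using e \<open>A = 0 \<and> B = 0\<close> \<open>k = 0\<close> pos(2) by (simp add: A_def)
    moreover have "int i - 1 = int i' - 1"
      using mod \<open>k = 0\<close> by (metis div_mult_mod_eq eq_iff_diff_eq_0 k_def)
    ultimately show ?thesis
      by simp
  qed
  have inj: "x = x' \<and> i = i'"
    if p: "(x, i) \<in> tower_dom 2 l h" "(x', i') \<in> tower_dom 2 l h" "\<phi> x (int i - 1) = \<phi> x' (int i' - 1)"
    for x x' i i'
    using inj_le[OF p] inj_le[OF p(2,1) p(3)[symmetric]] by linarith

  let ?T = "tower 2 swap12 l h" and ?V = "cyl_shift d \<theta> 0 1" and ?pos = "tower_pos 2 l h"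
  define G where "G y = (if y \<in> {0..<1}
    then (\<lambda>(x, i). \<phi> x (int i - 1)) (inv_into (tower_dom 2 l h) ?pos y) else y)" for y
  have G_pos: "G (?pos (x, i)) = \<phi> x (int i - 1)" if "(x, i) \<in> tower_dom 2 l h" for x i
    using bij_betwE[OF bij_betw_tower_pos] bij_betw_inv_into_left[OF bij_betw_tower_pos] that
    by (simp add: G_def)
  have ex: "\<exists>x i. (x, i) \<in> tower_dom 2 l h \<and> ?pos (x, i) = y" if "y \<in> {0..<1}" for y
    using bij_betw_imp_surj_on[OF bij_betw_tower_pos] that by (metis image_iff surj_pair)
  have G_inj: "inj_on G {0..<1}"
  proof (rule inj_onI)
    fix y y' assume y: "y \<in> {0..<1}" "y' \<in> {0..<1}" "G y = G y'"
    obtain x i where p: "(x, i) \<in> tower_dom 2 l h" "?pos (x, i) = y"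
      using ex[OF y(1)] by blast
    obtain x' i' where p': "(x', i') \<in> tower_dom 2 l h" "?pos (x', i') = y'"
      using ex[OF y(2)] by blast
    show "y = y'"
      using inj[OF p(1) p'(1)] G_pos[OF p(1)] G_pos[OF p'(1)] p(2) p'(2) y(3) by simp
  qed
  have G_IET: "G \<in> IETs"
  proof (rule IETs_I)
    show "G x = x" if "x \<notin> {0..<1}" for x
      unfolding G_def using that by (simp only: if_False)
    show "G ` {0..<1} \<subseteq> {0..<1}"
    proof clarify
      fix y :: real assume "y \<in> {0..<1}"
      then obtain x i where "(x, i) \<in> tower_dom 2 l h" "?pos (x, i) = y"
        using ex by blast
      then show "G y \<in> {0..<1}"
        using G_pos \<phi>_in by metis
    qed
    show "inj_on G {0..<1}" by fact
    obtain P where P: "finite P"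
      "\<And>y y'. \<lbrakk>0 \<le> y; y \<le> y'; y' < 1; {y<..y'} \<inter> P = {}\<rbrakk> \<Longrightarrow>
      \<exists>i u v. u \<le> v \<and> y' - y = (v - u) / height_sum \<and>
        (\<forall>w\<in>{u..v}. (w, i) \<in> tower_dom 2 l h \<and> ?pos (w, i) = y + (w - u) / height_sum)"
      using tower_pos_pieces by blast
    define F where "F = (\<lambda>k. of_int k / real d) ` {0..int d}"
    \<comment> \<open>Points sent to the boundary of a target level; a wrap of the circle coordinate
      lands there.\<close>
    define Q where "Q = G -` F \<inter> {0..<1}"
    show "piecewise_translation G"
    proof (rule piecewise_translationI)
      have "finite Q"
        unfolding Q_def by (rule finite_vimage_IntI[OF _ G_inj]) (simp add: F_def)
      then show "finite (P \<union> Q)"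
        using P(1) by simp
      fix y y' :: real
      assume y: "0 \<le> y" "y \<le> y'" "y' < 1" "{y<..y'} \<inter> (P \<union> Q) = {}"
      then obtain i u v where uv: "u \<le> v" "y' - y = (v - u) / height_sum"
        and w: "\<And>w. w \<in> {u..v} \<Longrightarrow> (w, i) \<in> tower_dom 2 l h"
          "\<And>w. w \<in> {u..v} \<Longrightarrow> ?pos (w, i) = y + (w - u) / height_sum"
        using P(2)[of y y'] by blast
      define N where "N = int i - 1"
      define e where "e = of_int (N div int d) * c / L"
      have Gw: "G (y + (w - u) / height_sum) = (of_int (N mod int d) + frac (w / L + e)) / real d"
        if "w \<in> {u..v}" for w
        using G_pos[OF w(1)[OF that]] w(2)[OF that]
        by (simp add: \<phi>_def N_def e_def add_divide_distrib)
      have "frac (v / L + e) - frac (u / L + e) = v / L - u / L"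
      proof (rule frac_diff_no_wrap)
        show "u / L \<le> v / L"
          using uv L by (simp add: divide_right_mono)
        fix z assume z: "u / L < z" "z \<le> v / L"
        have wz: "u < z * L" "z * L \<le> v"
          using z L by (simp_all add: field_simps)
        \<comment> \<open>The point of \<open>{y<..y'}\<close> over the base point
          \<open>z * L\<close>; a wrap at \<open>z\<close> would put it into
          \<open>Q\<close>.\<close>
        define t where "t = y + (z * L - u) / height_sum"
        have "t \<in> {y<..y'}"
        proof -
          have "(z * L - u) / height_sum \<le> (v - u) / height_sum"
            using wz height_sum_pos by (intro divide_right_mono) simp_all
          then show ?thesis
            using wz height_sum_pos uv(2) by (simp add: t_def)
        qed
        then have "t \<notin> Q"
          using y(4) by blast
        then have "G t \<notin> F"
          using \<open>t \<in> _\<close> y by (simp add: Q_def)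
        moreover have "G t = (of_int (N mod int d) + frac (z + e)) / real d"
          using Gw[of "z * L"] wz L by (simp add: t_def)
        moreover have "of_int (N mod int d) / real d \<in> F"
          unfolding F_def using pos(1) by (intro imageI) (simp add: less_imp_le)
        ultimately show "frac (z + e) \<noteq> 0"
          by (metis add_0_right)
      qed
      \<comment> \<open>Since \<open>height_sum = d * L\<close>, source and target scale base
        lengths by the same factor, which makes the slope of \<open>G\<close> equal to 1.\<close>
      then have "(frac (v / L + e) - frac (u / L + e)) / real d = (v - u) / height_sum"
        by (simp add: hs diff_divide_distrib mult.commute)
      then have "G (y + (v - u) / height_sum) - G (y + (u - u) / height_sum) = (v - u) / height_sum"
        using Gw[of v] Gw[of u] uv(1) by (simp add: diff_divide_distrib add_divide_distrib)
      moreover have "y + (v - u) / height_sum = y'" "y + (u - u) / height_sum = y"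
        using uv(2) by simp_all
      ultimately show "G y' - G y = y' - y"
        using uv(2) by metis
    qed
  qed

  \<comment> \<open>A carry adds \<theta>, which is \<open>c / L\<close> modulo 1, and so counts as
    one more rotation by \<open>c\<close>.\<close>
  have V\<phi>: "?V (\<phi> x N) = \<phi> x (N + 1)" for x N
  proof -
    define n where "n = N mod int d"
    define q where "q = N div int d"
    have N: "N + 1 = (n + 1) + q * int d"
      by (simp add: n_def q_def)
    have "(N + 1) mod int d = (n + 1) mod int d" "(N + 1) div int d = q + (n + 1) div int d"
      unfolding N using pos(1) by simp_all
    moreover define s where "s = (n + 1) div int d"
    moreover have "?V (\<phi> x N) = (of_int ((n + 1) mod int d)
        + frac (frac ((x + of_int q * c) / L) + 0 + \<theta> * of_int ((n + 1) div int d))) / real d"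
      unfolding \<phi>_def n_def[symmetric] q_def[symmetric]
      by (rule cyl_shift_point[OF pos(1)]) (use pos(1) in \<open>simp_all add: n_def frac_lt_1\<close>)
    moreover have "frac (frac ((x + of_int q * c) / L) + 0 + \<theta> * of_int s)
      = frac ((x + of_int (q + s) * c) / L)"
    proof -
      have "(x + of_int q * c) / L + \<theta> * of_int s
        = (x + of_int (q + s) * c) / L + of_int (- \<lfloor>c / L\<rfloor> * s)"
        by (simp add: \<theta>_def frac_def field_simps add_divide_distrib)
      then show ?thesis
        by (simp only: add_0_right frac_add_simps frac_add_of_int_right)
    qed
    ultimately show ?thesis
      by (simp add: \<phi>_def)
  qed
  \<comment> \<open>Column heights are multiples of \<open>d\<close>, so climbing past the top leads
    to level 0 after \<open>m'\<close> or \<open>n'\<close> rotations by \<open>c\<close>. Modulo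
    \<open>L\<close> these are translation by \<open>l 2\<close> or by \<open>- l 1\<close>, the two
    branches of the base rotation.\<close>
  have top: "\<phi> (iet 2 swap12 l x) 0 = \<phi> x (int (h (interv_index 2 l x)))" if x: "x \<in> {0..<1}" for x
  proof -
    define k where "k = (if x < l 1 then int m' else int n')"
    have hk: "int (h (interv_index 2 l x)) = k * int d"
      using interv_index_2[OF data x] by (simp add: h_def k_def)
    have "x + of_int k * c = iet 2 swap12 l x + of_int (if x < l 1 then a else b) * L"
    proof (cases "x < l 1")
      case True
      have "real m' * c - l 2 - of_int a * L
          = (real m' * of_int b - real n' * of_int a - 1) * l 2"
        by (simp add: c_def L_def algebra_simps)
      then show ?thesis
        using True ab_r rotation_apply[OF data x] by (simp add: k_def)
    next
      case False
      have "real n' * c + l 1 - of_int b * L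
          = (1 - (real m' * of_int b - real n' * of_int a)) * l 1"
        by (simp add: c_def L_def algebra_simps)
      then show ?thesis
        using False ab_r rotation_apply[OF data x] by (simp add: k_def)
    qed
    then have "(x + of_int k * c) / L = iet 2 swap12 l x / L + of_int (if x < l 1 then a else b)"
      using L by (simp add: add_divide_distrib)
    then have "frac ((x + of_int k * c) / L) = frac (iet 2 swap12 l x / L)"
      by (simp only: frac_add_of_int_right)
    then show ?thesis
      using pos(1) by (simp add: \<phi>_def hk)
  qed
  have "G (?T y) = ?V (G y)" for y
  proof (cases "y \<in> {0..<1}")
    case True
    then obtain x i where p: "(x, i) \<in> tower_dom 2 l h" "?pos (x, i) = y"
      using ex by blast
    obtain x' i' where p': "tower_map 2 swap12 l h (x, i) = (x', i')"
      by (metis surj_pair)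
    have "G (?T y) = \<phi> x' (int i' - 1)"
      using tower_tower_pos[OF p(1)] tower_map_in[OF p(1)] G_pos p(2) p' by metis
    also have "\<dots> = \<phi> x (int i)"
    proof (cases "i + 1 \<le> h (interv_index 2 l x)")
      case True
      then show ?thesis
        using p' by (auto simp: tower_map_def)
    next
      case False
      then have "h (interv_index 2 l x) = i"
        using p(1) by (simp add: tower_dom_def)
      then show ?thesis
        using False p' top[OF dom(1)[OF p(1)]] by (auto simp: tower_map_def)
    qed
    also have "\<dots> = ?V (G y)"
      using G_pos[OF p(1)] p(2) V\<phi>[of x "int i - 1"] by simp
    finally show ?thesis .
  next
    case False
    then have "?T y = y" "G y = y" "?V y = y"
      unfolding tower_def G_def cyl_shift_def by (simp_all only: if_False)
    then show ?thesis by simp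
  qed
  then have "conjugate ?T ?V"
    by (intro conjugateI[OF G_IET]) (simp add: fun_eq_iff)
  then show ?thesis
    using that \<theta>01 irr\<theta> unfolding h_def by blast
qed

section \<open>Rotation criterion, constant-height model and roots for towers of type (m, n)\<close>

theorem theorem1p8:
  fixes m n :: nat and T :: "real \<Rightarrow> real"
  assumes "0 < m" and "0 < n"
    and "tower_over_minimal_rotation m n T"
  shows "((\<exists>R. minimal_rotation R \<and> conjugate T R) \<longleftrightarrow> coprime m n)
    \<and> (\<forall>d. \<not> coprime m n \<and> d = gcd m n \<longrightarrow>
          (\<exists>T'. tower_over_minimal_rotation d d T' \<and> conjugate T T'))
    \<and> (\<exists>p\<ge>2. has_root p T)"
proof -
  obtain l where l: "iet_data 2 swap12 l" "minimal (iet 2 swap12 l)"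
    "T = tower 2 swap12 l (\<lambda>j. if j = 1 then m else n)"
    using assms(3) unfolding tower_over_minimal_rotation_def by blast
  define d where "d = gcd m n"
  have d: "0 < d"
    using assms by (simp add: d_def)
  obtain m' n' where mn: "m = m' * d" "n = n' * d" "coprime m' n'"
    using gcd_coprime_exists[of m n] d unfolding d_def by blast
  have m'n': "0 < m'" "0 < n'"
    using mn(1,2) assms(1,2) by (auto intro: Nat.gr0I)
  have "l 2 \<notin> \<rat>"
    using minimal_rotation_iff_irrational[OF l(1)] l(2) by simp
  then obtain \<theta> where \<theta>: "0 < \<theta>" "\<theta> < 1" "\<theta> \<notin> \<rat>"
    and conj: "conjugate T (cyl_shift d \<theta> 0 1)"
    by (rule conjugate_tower_cyl_shift[OF l(1) _ d m'n' mn(3)])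
      (simp only: l(3) mn(1,2) mult.commute[of d])
  \<comment> \<open>The second length is the rotation angle, so \<open>l'\<close> describes the
    rotation by \<theta>.\<close>
  define l' where "l' = (\<lambda>i::nat. if i = 1 then 1 - \<theta> else \<theta>)"
  have l': "iet_data 2 swap12 l'" "l' 2 = \<theta>"
    using iet_data_2I[OF \<theta>(1,2)] by (simp_all add: l'_def)
  have min': "minimal (iet 2 swap12 l')"
    using minimal_rotation_iff_irrational[OF l'(1)] \<theta>(3) l'(2) by simp
  have "coprime m n" if R: "minimal_rotation R" "conjugate T R" for R
  proof (rule ccontr)
    assume "\<not> coprime m n"
    then have "d \<noteq> 1"
      by (simp add: d_def coprime_iff_gcd_eq_1)
    then have "2 \<le> d"
      using d by simp
    obtain k where k: "iet_data 2 swap12 k" "R = iet 2 swap12 k" "minimal R"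
      using R(1) unfolding minimal_rotation_def by blast
    then have "k 2 \<notin> \<rat>"
      using minimal_rotation_iff_irrational by blast
    moreover have "conjugate (cyl_shift d \<theta> 0 1) R"
      using conjugate_trans[OF conjugate_sym[OF conj] R(2)] .
    ultimately show False
      using not_conjugate_rotation[OF \<open>2 \<le> d\<close> k(1)] k(2) by simp
  qed
  moreover have "\<exists>R. minimal_rotation R \<and> conjugate T R" if "coprime m n"
  proof -
    \<comment> \<open>Here \<open>d = 1\<close>, and a tower of height 1 is the rotation
      itself.\<close>
    have "iet 2 swap12 l' = cyl_shift d \<theta> 0 1"
      using rotation_eq_cyl_shift[OF l'(1)] l'(2) that by (simp add: d_def coprime_iff_gcd_eq_1)
    then show ?thesis
      using conj l'(1) min' unfolding minimal_rotation_def by metis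
  qed
  moreover have "\<exists>T'. tower_over_minimal_rotation d d T' \<and> conjugate T T'"
  proof -
    have "tower 2 swap12 l' (\<lambda>j. if j = 1 then d else d) = cyl_shift d \<theta> 0 1"
      using tower_constant_height[OF l'(1) d] l'(2) by simp
    then show ?thesis
      using conj l'(1) min' unfolding tower_over_minimal_rotation_def by metis
  qed
  moreover have "has_root (d + 1) T"
    using has_root_conjugate[OF conjugate_sym[OF conj] has_root_cyl_shift[OF d]] .
  then have "\<exists>p\<ge>2. has_root p T"
    using d by (intro exI[of _ "d + 1"]) simp
  ultimately show ?thesis
    unfolding d_def by blast
qed

end
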